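(* Let $\mathbb{M}^2=(\mathbb{R}^2,\|\cdot\|)$ be a normed plane, let $K=\{p_1,p_2,\dots,p_n\}\subset\mathbb{M}^2$ be a finite set with $n\ge 2$ distinct points, and let $\lambda\geq\lambda_K$. Let $\mathcal{H}$ be the set of all discs of radius $\lambda$ whose boundary contains a circular arc meeting points from $K$ (i.e. an arc with two distinct points of $K$ as endpoints). For $i\neq j$ let $\mathcal{A}_{ij}$ be the set of all minimal circular arcs $\widehat{p_ip_j}$ of radius $\lambda$ meeting $p_i$ and $p_j$. If $\mathbb{M}^2$ is strictly convex or $\lambda\geq\operatorname{diam}(K)$, then $$\operatorname{bh}(K,\lambda)=\bigcap_{K\subset B(x,\lambda)\in\mathcal{H}}B(x,\lambda)=\operatorname{conv}\Big(\bigcup_{i\ne j}\ \bigcup_{\widehat{p_ip_j}\in\mathcal{A}_{ij}}\widehat{p_ip_j}\Big).$$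
   Context: $B(x,\lambda)$ is the closed disc $\{y:\|y-x\|\le\lambda\}$ and $S(x,\lambda)$ its boundary circle ($\lambda>0$). The $\lambda$-ball hull of $K$ is $\operatorname{bh}(K,\lambda)=\bigcap_{K\subset B(x,\lambda)}B(x,\lambda)$. The circumradius $\lambda_K$ is the smallest number such that $K$ is contained in a disc of radius $\lambda_K$. $\operatorname{diam}(K)=\max\{\|x-y\|:x,y\in K\}$, and $\operatorname{conv}$ is the convex hull. For two distinct points $p,q\in S(x,\lambda)$, the minimal circular arc of $B(x,\lambda)$ meeting $p$ and $q$ is the piece of $S(x,\lambda)$ with endpoints $p$ and $q$ lying in the half-plane bounded by the line $\langle p,q\rangle$ and not containing the center $x$; if $p,q$ are opposite in $S(x,\lambda)$, both half-circles with endpoints $p,q$ are minimal circular arcs. A minimal circular arc of radius $\lambda$ meeting $p$ and $q$ (denoted $\widehat{pq}$) is such an arc for some center $x$. The plane is strictly convex if its unit circle contains no non-degenerate segment. *)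

theory Defs
  imports "HOL-Analysis.Analysis"
begin

type_synonym plane = "real^2"

text \<open>
  A normed plane is the vector space \<^typ>\<open>real^2\<close> with an arbitrary norm \<open>N\<close>. The built-in
  Euclidean structure is used only to describe half-planes and the topology (all norms on the
  plane induce the same one).
\<close>

definition plane_norm :: "(plane \<Rightarrow> real) \<Rightarrow> bool" where
  "plane_norm N \<longleftrightarrow>
     (\<forall>x. 0 \<le> N x) \<and>
     (\<forall>x. N x = 0 \<longleftrightarrow> x = 0) \<and>
     (\<forall>c x. N (c *\<^sub>R x) = \<bar>c\<bar> * N x) \<and>
     (\<forall>x y. N (x + y) \<le> N x + N y)"

definition disc :: "(plane \<Rightarrow> real) \<Rightarrow> plane \<Rightarrow> real \<Rightarrow> plane set" where
  "disc N x r = {y. N (y - x) \<le> r}"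

definition circle :: "(plane \<Rightarrow> real) \<Rightarrow> plane \<Rightarrow> real \<Rightarrow> plane set" where
  "circle N x r = {y. N (y - x) = r}"

definition strictly_convex :: "(plane \<Rightarrow> real) \<Rightarrow> bool" where
  "strictly_convex N \<longleftrightarrow> \<not> (\<exists>u v. u \<noteq> v \<and> closed_segment u v \<subseteq> circle N 0 1)"

definition ball_hull :: "(plane \<Rightarrow> real) \<Rightarrow> plane set \<Rightarrow> real \<Rightarrow> plane set" where
  "ball_hull N K r = \<Inter>{disc N x r | x. K \<subseteq> disc N x r}"

definition circumradius :: "(plane \<Rightarrow> real) \<Rightarrow> plane set \<Rightarrow> real" where
  "circumradius N K = (LEAST r. 0 \<le> r \<and> (\<exists>x. K \<subseteq> disc N x r))"

text \<open>Meaningful for finite nonempty sets only.\<close>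

definition diam :: "(plane \<Rightarrow> real) \<Rightarrow> plane set \<Rightarrow> real" where
  "diam N K = Max {N (x - y) | x y. x \<in> K \<and> y \<in> K}"

text \<open>
  \<open>A\<close> is an arc of the circle with endpoints \<open>u\<close> and \<open>v\<close>. Since \<^const>\<open>arc\<close> requires an injective
  path, \<open>u\<close> and \<open>v\<close> are distinct.
\<close>

definition circular_arc ::
    "(plane \<Rightarrow> real) \<Rightarrow> plane \<Rightarrow> real \<Rightarrow> plane \<Rightarrow> plane \<Rightarrow> plane set \<Rightarrow> bool" where
  "circular_arc N x r u v A \<longleftrightarrow>
     A \<subseteq> circle N x r \<and>
     (\<exists>g. arc g \<and> pathstart g = u \<and> pathfinish g = v \<and> path_image g = A)"

text \<open>
  The arc lies in a closed half-plane bounded by the line through \<open>u\<close> and \<open>v\<close>, here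
  \<open>{y. b \<le> a \<bullet> y}\<close>, which does not contain the centre unless \<open>u\<close> and \<open>v\<close> are opposite. The
  arc is not always the whole intersection of the circle with the half-plane: if the circle
  contains the segment from \<open>u\<close> to \<open>v\<close>, it can contain a longer segment of the same line, while
  the arc with endpoints \<open>u\<close> and \<open>v\<close> is just the segment between them.
\<close>

definition minimal_arc ::
    "(plane \<Rightarrow> real) \<Rightarrow> plane \<Rightarrow> real \<Rightarrow> plane \<Rightarrow> plane \<Rightarrow> plane set \<Rightarrow> bool" where
  "minimal_arc N x r u v A \<longleftrightarrow>
     circular_arc N x r u v A \<and>
     (\<exists>a b. a \<noteq> 0 \<and> a \<bullet> u = b \<and> a \<bullet> v = b \<and>
            A \<subseteq> {y. b \<le> a \<bullet> y} \<and>
            (x \<notin> {y. b \<le> a \<bullet> y} \<or> x = midpoint u v))"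

definition minimal_arcs ::
    "(plane \<Rightarrow> real) \<Rightarrow> real \<Rightarrow> plane \<Rightarrow> plane \<Rightarrow> plane set set" where
  "minimal_arcs N r u v = {A. \<exists>x. minimal_arc N x r u v A}"

definition arc_discs :: "(plane \<Rightarrow> real) \<Rightarrow> plane set \<Rightarrow> real \<Rightarrow> plane set set" where
  "arc_discs N K r =
     {disc N x r | x. \<exists>u\<in>K. \<exists>v\<in>K. u \<noteq> v \<and> (\<exists>A. circular_arc N x r u v A)}"

end

theory Submission
  imports Defs
begin

text \<open>
  Let \<open>C\<close> be the convex hull of the minimal arcs, and call a disc of radius \<open>lam\<close> touching if it
  contains \<open>K\<close> and has two points of \<open>K\<close> on its boundary. The theorem is the cycle
  \<open>C \<subseteq> ball_hull N K lam \<subseteq> (intersection of the touching discs) \<subseteq> C\<close>, whose middle inclusion is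
  immediate.

  For the first inclusion it suffices that every disc of radius \<open>lam\<close> containing two points \<open>u\<close>, \<open>v\<close>
  contains every minimal arc between them (\<open>minimal_arc_in_disc\<close>). With the centre of the arc as
  the origin, the arc lies in the convex cone spanned by \<open>u\<close> and \<open>v\<close>, and the claim becomes a
  computation with coordinates in the basis \<open>u\<close>, \<open>v\<close>. The computation only breaks down if \<open>u\<close> and
  \<open>v\<close> lie on opposite parallel segments of the circle, at distance \<open>2 * lam\<close>; strict convexity
  and \<open>lam \<ge> diam N K\<close> both rule this out.

  For the last inclusion let \<open>q\<close> lie outside \<open>C\<close>. The set \<open>C\<close> is compact, so there are linear
  functionals \<open>f\<close> with \<open>f(c) < f(q)\<close> for all \<open>c\<close> in \<open>C\<close>; these form an open convex cone \<open>F\<close>. For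
  such an \<open>f\<close> push a disc containing \<open>K\<close> as far down as possible, that is, minimise \<open>f(z)\<close> over the
  admissible centres \<open>z\<close>. By Helly's theorem two points of \<open>K\<close> block the motion, and a separation
  argument at these two points (\<open>top_of_optimal_disc\<close>) shows that \<open>f\<close> attains its maximum over the
  disc either at a point \<open>k\<close> of \<open>K\<close> or on a minimal arc between two points of \<open>K\<close> on the boundary.
  In the second case the disc is touching and lies below \<open>q\<close>. The first case gives no second point on
  the boundary, but if it occurs for every \<open>f\<close> in \<open>F\<close>, then \<open>k\<close> cannot change with \<open>f\<close>
  because \<open>F\<close> is connected. This forces \<open>F\<close> to be the whole open half-plane of functionals with
  \<open>f(k) < f(q)\<close>, and letting \<open>f\<close> tend to a functional \<open>h\<close> with \<open>h(k) = h(q)\<close> produces a touching disc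
  on whose boundary \<open>k\<close> is the last point in direction \<open>q - k\<close> (\<open>touching_disc_excludes\<close>). So some
  touching disc excludes \<open>q\<close> in every case.
\<close>

section \<open>Coordinates in the plane\<close>

definition wedge :: "plane \<Rightarrow> plane \<Rightarrow> real" where
  "wedge a b = a $ 1 * b $ 2 - a $ 2 * b $ 1"

definition perp :: "plane \<Rightarrow> plane" where
  "perp a = vector [- (a $ 2), a $ 1]"

lemma wedge_simps [simp]:
  "wedge a a = 0"
  "wedge (a + b) c = wedge a c + wedge b c"
  "wedge a (b + c) = wedge a b + wedge a c"
  "wedge (a - b) c = wedge a c - wedge b c"
  "wedge a (b - c) = wedge a b - wedge a c"
  "wedge (- a) c = - wedge a c"
  "wedge a (- c) = - wedge a c"
  "wedge (k *\<^sub>R a) b = k * wedge a b"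
  "wedge a (k *\<^sub>R b) = k * wedge a b"
  "wedge 0 b = 0" "wedge a 0 = 0"
  by (simp_all add: wedge_def algebra_simps)

lemma wedge_commute: "wedge b a = - wedge a b"
  by (simp add: wedge_def)

lemma inner_perp: "perp a \<bullet> b = wedge a b"
  by (simp add: perp_def wedge_def inner_vec_def sum_2)

lemma perp_eq_0_iff [simp]: "perp a = 0 \<longleftrightarrow> a = 0"
  by (auto simp: perp_def vec_eq_iff forall_2)

text \<open>
  Cramer's rule: \<^term>\<open>wedge\<close> is the determinant, and quotients of determinants are the coordinates
  in a basis.
\<close>
lemma wedge_expansion:
  assumes "wedge a b \<noteq> 0"
  shows "y = (wedge y b / wedge a b) *\<^sub>R a + (wedge a y / wedge a b) *\<^sub>R b"
proof -
  have "wedge a b *\<^sub>R y = wedge y b *\<^sub>R a + wedge a y *\<^sub>R b"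
    by (simp add: vec_eq_iff forall_2 wedge_def algebra_simps)
  then have "(1 / wedge a b) *\<^sub>R (wedge a b *\<^sub>R y)
      = (1 / wedge a b) *\<^sub>R (wedge y b *\<^sub>R a + wedge a y *\<^sub>R b)" by simp
  with assms show ?thesis by (simp add: scaleR_add_right)
qed

lemma wedge_eq_0_imp_parallel:
  assumes "wedge a b = 0" "a \<noteq> 0"
  obtains k where "b = k *\<^sub>R a"
proof -
  have eq: "(a \<bullet> a) *\<^sub>R b = (a \<bullet> b) *\<^sub>R a"
    using assms(1)
    by (simp add: vec_eq_iff forall_2 wedge_def inner_vec_def sum_2 algebra_simps)
  have "b = (1 / (a \<bullet> a)) *\<^sub>R ((a \<bullet> a) *\<^sub>R b)"
    using assms(2) by simp
  then have "b = ((a \<bullet> b) / (a \<bullet> a)) *\<^sub>R a" unfolding eq by simp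
  then show ?thesis using that by blast
qed

lemma continuous_on_wedge [continuous_intros]:
  assumes "continuous_on S f" "continuous_on S g"
  shows "continuous_on S (\<lambda>x. wedge (f x) (g x))"
  unfolding wedge_def by (intro continuous_intros assms)

section \<open>Discs and circles of a normed plane\<close>

locale normed_plane =
  fixes N :: "plane \<Rightarrow> real"
  assumes is_norm: "plane_norm N"
begin

lemma N_nonneg [simp]: "0 \<le> N x"
  and N_eq_0_iff [simp]: "N x = 0 \<longleftrightarrow> x = 0"
  and N_scale: "N (c *\<^sub>R x) = \<bar>c\<bar> * N x"
  and N_triangle: "N (x + y) \<le> N x + N y"
  using is_norm unfolding plane_norm_def by blast+

lemma N_0 [simp]: "N 0 = 0"
  by simp

lemma N_pos_iff [simp]: "0 < N x \<longleftrightarrow> x \<noteq> 0"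
  using N_nonneg[of x] N_eq_0_iff[of x] by linarith

lemma N_minus [simp]: "N (- x) = N x"
  using N_scale[of "-1" x] by simp

lemma N_minus_commute: "N (x - y) = N (y - x)"
  using N_minus[of "x - y"] by simp

lemma N_combination_le:
  assumes "N x \<le> r" "N y \<le> r" "0 \<le> a" "0 \<le> b"
  shows "N (a *\<^sub>R x + b *\<^sub>R y) \<le> (a + b) * r"
proof -
  have "N (a *\<^sub>R x + b *\<^sub>R y) \<le> a * N x + b * N y"
    using N_triangle[of "a *\<^sub>R x" "b *\<^sub>R y"] assms by (simp add: N_scale)
  also have "\<dots> \<le> a * r + b * r"
    using assms by (intro add_mono mult_left_mono)
  finally show ?thesis by (simp add: algebra_simps)
qed

text \<open>
  Triangle inequalities for the triangle with sides \<open>a x\<close>, \<open>b y\<close> and their sum, whose lengths are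
  \<open>\<bar>a\<bar>\<close>, \<open>\<bar>b\<bar>\<close> and \<open>1\<close> in units of \<open>r\<close>.
\<close>
lemma coordinate_bounds_on_circle:
  assumes "N x = r" "N y = r" "r > 0" "N (a *\<^sub>R x + b *\<^sub>R y) = r"
  shows "\<bar>1 - \<bar>a\<bar>\<bar> \<le> \<bar>b\<bar>" and "\<bar>1 - \<bar>b\<bar>\<bar> \<le> \<bar>a\<bar>"
proof -
  have cancel: "s \<le> t" if "s * r \<le> t * r" for s t :: real
    using that \<open>r > 0\<close> by simp
  have 1: "r \<le> \<bar>a\<bar> * r + \<bar>b\<bar> * r"
    using N_triangle[of "a *\<^sub>R x" "b *\<^sub>R y"] assms by (simp add: N_scale)
  have 2: "\<bar>a\<bar> * r \<le> r + \<bar>b\<bar> * r"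
    using N_triangle[of "a *\<^sub>R x + b *\<^sub>R y" "- (b *\<^sub>R y)"] assms by (simp add: N_scale)
  have 3: "\<bar>b\<bar> * r \<le> r + \<bar>a\<bar> * r"
    using N_triangle[of "a *\<^sub>R x + b *\<^sub>R y" "- (a *\<^sub>R x)"] assms by (simp add: N_scale)
  have "1 \<le> \<bar>a\<bar> + \<bar>b\<bar>" by (rule cancel) (use 1 in \<open>simp add: algebra_simps\<close>)
  moreover have "\<bar>a\<bar> \<le> 1 + \<bar>b\<bar>" by (rule cancel) (use 2 in \<open>simp add: algebra_simps\<close>)
  moreover have "\<bar>b\<bar> \<le> 1 + \<bar>a\<bar>" by (rule cancel) (use 3 in \<open>simp add: algebra_simps\<close>)
  ultimately show "\<bar>1 - \<bar>a\<bar>\<bar> \<le> \<bar>b\<bar>" "\<bar>1 - \<bar>b\<bar>\<bar> \<le> \<bar>a\<bar>" by linarith+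
qed

lemma convex_on_N: "convex_on UNIV N"
proof (rule convex_onI)
  fix t :: real and x y
  assume "0 < t" "t < 1"
  then show "N ((1 - t) *\<^sub>R x + t *\<^sub>R y) \<le> (1 - t) * N x + t * N y"
    using N_triangle[of "(1 - t) *\<^sub>R x" "t *\<^sub>R y"] by (simp add: N_scale)
qed simp

lemma continuous_on_N [continuous_intros]:
  assumes "continuous_on S f"
  shows "continuous_on S (\<lambda>x. N (f x))"
proof -
  have "continuous_on UNIV N"
    using convex_on_continuous[OF open_UNIV convex_on_N] .
  then show ?thesis
    using assms continuous_on_compose2 by blast
qed

lemma N_ge_norm: obtains c where "c > 0" "\<And>x. c * norm x \<le> N x"
proof -
  have "compact (sphere (0::plane) 1)" "sphere (0::plane) 1 \<noteq> {}" by auto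
  then obtain s where s: "s \<in> sphere (0::plane) 1" "\<And>x. x \<in> sphere 0 1 \<Longrightarrow> N s \<le> N x"
    using continuous_attains_inf[of "sphere (0::plane) 1" N] continuous_on_N[OF continuous_on_id]
    by (metis (no_types, lifting))
  have "N s * norm x \<le> N x" for x
  proof (cases "x = 0")
    case False
    then have "N s \<le> N ((1 / norm x) *\<^sub>R x)" by (intro s(2)) simp
    with False show ?thesis by (simp add: N_scale field_simps)
  qed simp
  moreover have "s \<noteq> 0" using s(1) by auto
  then have "N s > 0" by simp
  ultimately show ?thesis using that by blast
qed

lemma convex_disc: "convex (disc N x r)"
  unfolding convex_alt
proof safe
  fix a b and t :: real
  assume "a \<in> disc N x r" "b \<in> disc N x r" "0 \<le> t" "t \<le> 1"
  then have "N ((1 - t) *\<^sub>R (a - x) + t *\<^sub>R (b - x)) \<le> ((1 - t) + t) * r"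
    unfolding disc_def by (intro N_combination_le) auto
  moreover have "(1 - t) *\<^sub>R (a - x) + t *\<^sub>R (b - x) = (1 - t) *\<^sub>R a + t *\<^sub>R b - x"
    by (simp add: algebra_simps)
  ultimately show "(1 - t) *\<^sub>R a + t *\<^sub>R b \<in> disc N x r"
    by (simp add: disc_def)
qed

lemma compact_disc: "compact (disc N x r)"
proof -
  obtain c where c: "c > 0" "\<And>x. c * norm x \<le> N x" using N_ge_norm by blast
  have "disc N x r \<subseteq> cball x (r / c)"
  proof
    fix y assume "y \<in> disc N x r"
    then have "c * norm (y - x) \<le> r" using c(2)[of "y - x"] by (simp add: disc_def)
    with c(1) show "y \<in> cball x (r / c)"
      by (simp add: dist_norm norm_minus_commute field_simps)
  qed
  then have "bounded (disc N x r)" using bounded_cball bounded_subset by blast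
  moreover have "closed (disc N x r)"
    unfolding disc_def by (intro closed_Collect_le continuous_intros)
  ultimately show ?thesis by (simp add: compact_eq_bounded_closed)
qed

text \<open>
  If \<open>a\<close> and \<open>b\<close> lie in the disc and their midpoint does not lie in its interior, then the
  reflection \<open>p'\<close> of a point \<open>p\<close> of the segment in that midpoint shows that \<open>p\<close> is not in the
  interior either. So the whole segment lies on the circle.
\<close>
lemma strictly_convex_sum_eq:
  assumes "strictly_convex N" "r > 0" "N a \<le> r" "N b \<le> r" "2 * r \<le> N (a + b)"
  shows "a = b"
proof (rule ccontr)
  assume "a \<noteq> b"
  have "closed_segment ((1/r) *\<^sub>R a) ((1/r) *\<^sub>R b) \<subseteq> circle N 0 1"
  proof
    fix p assume "p \<in> closed_segment ((1/r) *\<^sub>R a) ((1/r) *\<^sub>R b)"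
    then obtain t where t: "0 \<le> t" "t \<le> 1" "p = (1 - t) *\<^sub>R (1/r) *\<^sub>R a + t *\<^sub>R (1/r) *\<^sub>R b"
      by (auto simp: in_segment)
    let ?p = "(1 - t) *\<^sub>R a + t *\<^sub>R b" and ?p' = "t *\<^sub>R a + (1 - t) *\<^sub>R b"
    have "N ?p \<le> ((1 - t) + t) * r" "N ?p' \<le> (t + (1 - t)) * r"
      using t assms N_combination_le[of a r b "1 - t" t] N_combination_le[of a r b t "1 - t"]
      by simp_all
    moreover have "?p + ?p' = a + b" by (simp add: algebra_simps)
    then have "N (a + b) \<le> N ?p + N ?p'" using N_triangle[of ?p ?p'] by simp
    ultimately have "N ?p = r" using assms(5) by simp
    moreover have "p = (1/r) *\<^sub>R ?p" using t(3) by (simp add: scaleR_add_right)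
    ultimately show "p \<in> circle N 0 1" using \<open>r > 0\<close> by (simp add: circle_def N_scale)
  qed
  moreover have "(1/r) *\<^sub>R a \<noteq> (1/r) *\<^sub>R b" using \<open>a \<noteq> b\<close> \<open>r > 0\<close> by simp
  ultimately show False using assms(1) unfolding strictly_convex_def by blast
qed

lemma compact_circle: "compact (circle N x r)"
proof -
  have "closed (circle N x r)"
    unfolding circle_def by (intro closed_Collect_eq continuous_intros)
  moreover have "circle N x r = circle N x r \<inter> disc N x r"
    by (auto simp: circle_def disc_def)
  ultimately show ?thesis using compact_disc closed_Int_compact by metis
qed

text \<open>
  Points at distance \<open>2 * r\<close> fit into only one disc of radius \<open>r\<close>, so the extreme case of the minimal
  arcs needs no further geometry.
\<close>
lemma opposite_center_unique:
  assumes "strictly_convex N" "r > 0" "N (u - v) = 2 * r" "N (u - x) \<le> r" "N (v - x) \<le> r"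
  shows "x = midpoint u v"
proof -
  have "u - x = x - v"
    using strictly_convex_sum_eq[of r "u - x" "x - v"] assms by (simp add: N_minus_commute)
  then have "u + v = 2 *\<^sub>R x" unfolding scaleR_2 by (simp add: algebra_simps)
  then show ?thesis by (simp add: midpoint_def)
qed

lemma ball_hull_convex: "convex (ball_hull N K r)"
  unfolding ball_hull_def by (rule convex_Inter) (use convex_disc in blast)

text \<open>
  The circumradius is a least element, so its defining property is available only once the infimum
  is known to be attained. Restricting the centres to a large disc around a point of \<open>K\<close> makes the set
  of competing radii compact.
\<close>
lemma ex_covering_disc:
  assumes K: "finite K" "K \<noteq> {}" and le: "circumradius N K \<le> r"
  obtains z where "K \<subseteq> disc N z r"
proof -
  obtain k where "k \<in> K" using K by blast
  define R where "R = (\<Sum>k'\<in>K. N (k' - k))"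
  have R: "K \<subseteq> disc N k R"
    unfolding R_def disc_def using member_le_sum[of _ K "\<lambda>k'. N (k' - k)"] K by auto
  then have "0 \<le> R" using \<open>k \<in> K\<close> by (auto simp: disc_def)
  define S where "S = {0..R} \<inter> {s. \<exists>z. z \<in> disc N k R \<and> (z, s) \<in> {p. \<forall>k'\<in>K. N (k' - fst p) \<le> snd p}}"
  have S: "s \<in> S \<longleftrightarrow> 0 \<le> s \<and> s \<le> R \<and> (\<exists>z. z \<in> disc N k R \<and> K \<subseteq> disc N z s)" for s
    by (auto simp: S_def disc_def)
  have "closed {p :: plane \<times> real. \<forall>k'\<in>K. N (k' - fst p) \<le> snd p}"
    unfolding Ball_def
    by (intro closed_Collect_all closed_Collect_imp open_Collect_const closed_Collect_le continuous_intros)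
  then have "compact S"
    unfolding S_def by (intro compact_Int_closed closed_compact_projection[OF compact_disc]) auto
  moreover have "k \<in> disc N k R" using \<open>0 \<le> R\<close> by (simp add: disc_def)
  then have "R \<in> S" using R \<open>0 \<le> R\<close> S by blast
  ultimately obtain s where s: "s \<in> S" "\<And>t. t \<in> S \<Longrightarrow> s \<le> t"
    using compact_attains_inf[of S] by blast
  have "circumradius N K = s"
    unfolding circumradius_def
  proof (rule Least_equality)
    show "0 \<le> s \<and> (\<exists>x. K \<subseteq> disc N x s)" using s(1) S by blast
    fix t assume t: "0 \<le> t \<and> (\<exists>x. K \<subseteq> disc N x t)"
    then obtain z where z: "K \<subseteq> disc N z t" by blast
    show "s \<le> t"
    proof (cases "t \<le> R")
      case True
      have "N (k - z) \<le> t" using z \<open>k \<in> K\<close> by (auto simp: disc_def)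
      then have "z \<in> disc N k R" using True N_minus_commute[of z k] by (simp add: disc_def)
      then show ?thesis using s(2) S t True z by blast
    next
      case False
      then show ?thesis using s(1) S by force
    qed
  qed
  then have "s \<le> r" using le by simp
  obtain z where "K \<subseteq> disc N z s" using s(1) S by blast
  then have "K \<subseteq> disc N z r" using \<open>s \<le> r\<close> by (force simp: disc_def)
  then show ?thesis by (rule that)
qed
section \<open>Arcs of a circle\<close>
text \<open>
  Arcs of the circle are obtained by projecting a curve radially from the centre; the projection is
  injective if the curve meets every ray from the centre at most once.
\<close>
lemma radial_arc:
  assumes r: "r > 0" and cont: "continuous_on {0..1} h"
    and nz: "\<And>t. t \<in> {0..1} \<Longrightarrow> h t \<noteq> 0"
    and rays: "\<And>s t c. \<lbrakk>s \<in> {0..1}; t \<in> {0..1}; 0 < c; h s = c *\<^sub>R h t\<rbrakk> \<Longrightarrow> s = t"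
    and ends: "N (h 0) = r" "N (h 1) = r"
  shows "circular_arc N x r (x + h (0::real)) (x + h 1) ((\<lambda>t. x + (r / N (h t)) *\<^sub>R h t) ` {0..1})"
proof -
  define g where "g t = x + (r / N (h t)) *\<^sub>R h t" for t :: real
  have pos: "0 < N (h t)" if "t \<in> {0..1}" for t
    using nz[OF that] by simp
  have "path g"
    unfolding path_def g_def using cont pos by (intro continuous_intros) force+
  moreover have "inj_on g {0..1}"
  proof (rule inj_onI)
    fix s t :: real assume st: "s \<in> {0..1}" "t \<in> {0..1}" and "g s = g t"
    then have eq: "(r / N (h s)) *\<^sub>R h s = (r / N (h t)) *\<^sub>R h t" by (simp add: g_def)
    have "h s = (N (h s) / r) *\<^sub>R (r / N (h s)) *\<^sub>R h s"
      using r pos[OF st(1)] by simp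
    also have "\<dots> = (N (h s) / N (h t)) *\<^sub>R h t"
      unfolding eq using r by simp
    finally show "s = t" using rays[OF st] pos[OF st(1)] pos[OF st(2)] by (metis divide_pos_pos)
  qed
  moreover have "g ` {0..1} \<subseteq> circle N x r"
    using pos r by (fastforce simp: g_def circle_def N_scale)
  moreover have "g 0 = x + h 0" "g 1 = x + h 1"
    using ends r by (simp_all add: g_def)
  ultimately have "circular_arc N x r (x + h 0) (x + h 1) (g ` {0..1})"
    unfolding circular_arc_def arc_def
    by (auto intro!: exI[of _ g] simp: pathstart_def pathfinish_def path_image_def)
  then show ?thesis by (simp add: g_def[abs_def])
qed

text \<open>
  The projection of the segment from \<open>u\<close> to \<open>v\<close> is the minimal arc, and it covers all points of the
  circle in the cone spanned by \<open>u\<close> and \<open>v\<close>.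
\<close>
lemma sector_arc:
  assumes r: "r > 0" and u: "N u = r" and v: "N v = r" and indep: "wedge u v \<noteq> 0"
  obtains A where "minimal_arc N x r (x + u) (x + v) A"
    and "\<And>\<alpha> \<beta>. \<lbrakk>0 \<le> \<alpha>; 0 \<le> \<beta>; N (\<alpha> *\<^sub>R u + \<beta> *\<^sub>R v) = r\<rbrakk> \<Longrightarrow> x + (\<alpha> *\<^sub>R u + \<beta> *\<^sub>R v) \<in> A"
proof -
  define h where "h t = (1 - t) *\<^sub>R u + t *\<^sub>R v" for t :: real
  define A where "A = (\<lambda>t. x + (r / N (h t)) *\<^sub>R h t) ` {0..1}"
  have w: "wedge u (h t) = t * wedge u v" "wedge (h t) v = (1 - t) * wedge u v" for t
    by (simp_all add: h_def)
  have coords: "1 - s = c * (1 - t) \<and> s = c * t" if "h s = c *\<^sub>R h t" for s c t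
  proof -
    have "wedge (h s) v = wedge (c *\<^sub>R h t) v" "wedge u (h s) = wedge u (c *\<^sub>R h t)"
      using that by simp_all
    then have "(1 - s) * wedge u v = (c * (1 - t)) * wedge u v" "s * wedge u v = (c * t) * wedge u v"
      by (simp_all add: w)
    with indep show ?thesis by (metis mult_right_cancel)
  qed
  have nz: "h t \<noteq> 0" for t
    using coords[of t 0 t] by auto
  have arc: "circular_arc N x r (x + u) (x + v) A"
  proof -
    have "circular_arc N x r (x + h 0) (x + h 1) A"
      unfolding A_def
    proof (rule radial_arc[OF r _ nz])
      show "continuous_on {0..1} h" unfolding h_def by (intro continuous_intros)
      show "s = t" if "h s = c *\<^sub>R h t" for s t c
      proof -
        have "c = (1 - s) + s" using coords[OF that] by (metis add.commute diff_add_cancel distrib_left mult.right_neutral)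
        then show ?thesis using coords[OF that] by simp
      qed
    qed (simp_all add: h_def u v)
    then show ?thesis by (simp add: h_def)
  qed
  have "minimal_arc N x r (x + u) (x + v) A"
    unfolding minimal_arc_def
  proof (intro conjI arc exI)
    \<comment> \<open>A normal of the line through the end points; the sign of \<^term>\<open>wedge u v\<close> turns it away from
      the centre, whatever the orientation of \<open>u\<close> and \<open>v\<close>.\<close>
    define a where "a = - wedge u v *\<^sub>R perp (v - u)"
    have a: "a \<bullet> y = wedge u v * (wedge u y - wedge v y)" for y
      by (simp add: a_def inner_perp algebra_simps)
    have au: "a \<bullet> u = (wedge u v)\<^sup>2" "a \<bullet> v = (wedge u v)\<^sup>2"
      by (simp_all add: a power2_eq_square wedge_commute[of u v])
    show "a \<noteq> 0"
      using indep au by auto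
    show "a \<bullet> (x + u) = a \<bullet> (x + u)" ..
    show "a \<bullet> (x + v) = a \<bullet> (x + u)" by (simp add: inner_add_right au)
    show "A \<subseteq> {y. a \<bullet> (x + u) \<le> a \<bullet> y}"
    proof
      fix y assume "y \<in> A"
      then obtain t where t: "t \<in> {0..1}" "y = x + (r / N (h t)) *\<^sub>R h t"
        by (auto simp: A_def)
      have "N (h t) \<le> ((1 - t) + t) * r"
        unfolding h_def using t u v by (intro N_combination_le) auto
      moreover have "0 < N (h t)" using nz[of t] by simp
      ultimately have "1 \<le> r / N (h t)" by simp
      moreover have "a \<bullet> h t = (wedge u v)\<^sup>2"
        by (simp add: h_def inner_add_right inner_diff_right au algebra_simps)
      ultimately have "a \<bullet> u \<le> (r / N (h t)) * (a \<bullet> h t)"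
        using mult_right_mono[of 1 "r / N (h t)" "(wedge u v)\<^sup>2"] by (simp add: au)
      then show "y \<in> {y. a \<bullet> (x + u) \<le> a \<bullet> y}"
        by (simp add: t inner_add_right)
    qed
    show "x \<notin> {y. a \<bullet> (x + u) \<le> a \<bullet> y} \<or> x = midpoint (x + u) (x + v)"
      using indep by (simp add: inner_add_right au)
  qed
  moreover have "x + (\<alpha> *\<^sub>R u + \<beta> *\<^sub>R v) \<in> A"
    if ab: "0 \<le> \<alpha>" "0 \<le> \<beta>" and y: "N (\<alpha> *\<^sub>R u + \<beta> *\<^sub>R v) = r" for \<alpha> \<beta>
  proof -
    let ?y = "\<alpha> *\<^sub>R u + \<beta> *\<^sub>R v"
    have s: "0 < \<alpha> + \<beta>"
      using ab y r by (cases "\<alpha> = 0 \<and> \<beta> = 0") auto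
    define t where "t = \<beta> / (\<alpha> + \<beta>)"
    have "t \<in> {0..1}" using ab s by (auto simp: t_def)
    have "1 - t = \<alpha> / (\<alpha> + \<beta>)" using s by (simp add: t_def field_simps)
    then have ht: "h t = (1 / (\<alpha> + \<beta>)) *\<^sub>R ?y"
      by (simp add: h_def t_def scaleR_add_right)
    have "N (h t) = r / (\<alpha> + \<beta>)" using s y by (simp add: ht N_scale)
    then have "(r / N (h t)) *\<^sub>R h t = ?y" using r s by (simp add: ht)
    then show ?thesis using \<open>t \<in> {0..1}\<close> by (auto simp: A_def intro!: image_eqI[of _ _ t])
  qed
  ultimately show ?thesis using that by blast
qed

text \<open>
  For opposite points the segment passes through the centre and cannot be projected. The parabola
  below joins \<open>u\<close> to \<open>- u\<close> and bulges towards \<open>y\<close>, so that its midpoint projects to \<open>y\<close>.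
\<close>
lemma half_circle_arc:
  assumes r: "r > 0" and u: "N u = r" and y: "N y = r" and indep: "wedge u y \<noteq> 0"
  obtains A where "minimal_arc N x r (x + u) (x - u) A" and "x + y \<in> A"
proof -
  define h where "h t = (1 - 2 * t) *\<^sub>R u + (t * (1 - t)) *\<^sub>R y" for t :: real
  define A where "A = (\<lambda>t. x + (r / N (h t)) *\<^sub>R h t) ` {0..1}"
  have w: "wedge u (h t) = (t * (1 - t)) * wedge u y" "wedge (h t) y = (1 - 2 * t) * wedge u y" for t
    by (simp_all add: h_def)
  have coords: "1 - 2 * s = c * (1 - 2 * t) \<and> s * (1 - s) = c * (t * (1 - t))"
    if "h s = c *\<^sub>R h t" for s c t
  proof -
    have "wedge (h s) y = wedge (c *\<^sub>R h t) y" "wedge u (h s) = wedge u (c *\<^sub>R h t)"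
      using that by simp_all
    then have "(1 - 2 * s) * wedge u y = (c * (1 - 2 * t)) * wedge u y"
       "(s * (1 - s)) * wedge u y = (c * (t * (1 - t))) * wedge u y"
      by (simp_all add: w)
    with indep show ?thesis by (metis mult_right_cancel)
  qed
  have nz: "h t \<noteq> 0" for t
    using coords[of t 0 t] by auto
  have arc: "circular_arc N x r (x + u) (x - u) A"
  proof -
    have "circular_arc N x r (x + h 0) (x + h 1) A"
      unfolding A_def
    proof (rule radial_arc[OF r _ nz])
      show "continuous_on {0..1} h" unfolding h_def by (intro continuous_intros)
      show "s = t" if st: "s \<in> {0..1}" "t \<in> {0..1}" and "0 < c" "h s = c *\<^sub>R h t" for s t c
      proof (rule ccontr)
        assume "s \<noteq> t"
        note c = coords[OF \<open>h s = c *\<^sub>R h t\<close>]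
        have "(1 - 2 * s) * (t * (1 - t)) = (1 - 2 * t) * (s * (1 - s))"
          using c by simp
        \<comment> \<open>The second factor vanishes only if \<open>s\<close> and \<open>t\<close> are \<open>0\<close> and \<open>1\<close>: the two end points are
          on the same line but on opposite rays.\<close>
        then have "(t - s) * ((1 - t) * (1 - s) + s * t) = 0"
          by (simp add: algebra_simps)
        then have "(1 - t) * (1 - s) + s * t = 0" using \<open>s \<noteq> t\<close> by simp
        moreover have "0 \<le> (1 - t) * (1 - s)" "0 \<le> s * t"
          using st by auto
        ultimately have "(1 - t) * (1 - s) = 0" "s * t = 0" by linarith+
        then have "s = 0 \<and> t = 1 \<or> s = 1 \<and> t = 0" by auto
        then show False using c \<open>0 < c\<close> by auto
      qed
    qed (simp_all add: h_def u)
    then show ?thesis by (simp add: h_def)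
  qed
  have "minimal_arc N x r (x + u) (x - u) A"
    unfolding minimal_arc_def
  proof (intro conjI arc exI)
    define a where "a = wedge u y *\<^sub>R perp u"
    have a: "a \<bullet> p = wedge u y * wedge u p" for p
      by (simp add: a_def inner_perp)
    show "a \<noteq> 0"
      using indep by (auto simp: a_def)
    show "a \<bullet> (x + u) = a \<bullet> x" "a \<bullet> (x - u) = a \<bullet> x" by (simp_all add: a)
    show "A \<subseteq> {p. a \<bullet> x \<le> a \<bullet> p}"
    proof
      fix p assume "p \<in> A"
      then obtain t where t: "t \<in> {0..1}" "p = x + (r / N (h t)) *\<^sub>R h t"
        by (auto simp: A_def)
      have "0 \<le> (r / N (h t)) * ((t * (1 - t)) * (wedge u y)\<^sup>2)"
        using t r by (intro mult_nonneg_nonneg divide_nonneg_nonneg) auto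
      also have "\<dots> = (r / N (h t)) * (a \<bullet> h t)"
        by (simp add: a w power2_eq_square)
      finally show "p \<in> {p. a \<bullet> x \<le> a \<bullet> p}"
        by (simp add: t inner_add_right)
    qed
    show "x \<notin> {y. a \<bullet> x \<le> a \<bullet> y} \<or> x = midpoint (x + u) (x - u)"
      by (simp add: midpoint_def flip: scaleR_2)
  qed
  moreover have "x + y \<in> A"
  proof -
    have "h (1/2) = (1/4) *\<^sub>R y" by (simp add: h_def)
    then have "(r / N (h (1/2))) *\<^sub>R h (1/2) = y" using r y by (simp add: N_scale)
    then show ?thesis by (auto simp: A_def intro!: image_eqI[of _ _ "1/2"])
  qed
  ultimately show ?thesis using that by blast
qed

lemma not_parallel_on_circle:
  assumes "r > 0" "N u = r" "N v = r" "wedge u v = 0" "u \<noteq> v"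
  shows "v = - u"
proof -
  have "u \<noteq> 0" using assms by auto
  then obtain k where k: "v = k *\<^sub>R u" using wedge_eq_0_imp_parallel assms(4) by blast
  then have "\<bar>k\<bar> = 1" using assms by (simp add: N_scale)
  then show ?thesis using k assms(5) by (auto simp: abs_if split: if_splits)
qed

lemma ex_independent_on_circle:
  assumes "r > 0" "u \<noteq> 0"
  obtains y where "N y = r" "wedge u y \<noteq> 0"
proof -
  let ?p = "perp u"
  have "0 < N ?p" using assms by simp
  moreover have "wedge u ?p \<noteq> 0"
    using assms inner_perp[of u ?p] by (metis inner_eq_zero_iff perp_eq_0_iff)
  moreover have "N ((r / N ?p) *\<^sub>R ?p) = \<bar>r / N ?p\<bar> * N ?p" by (rule N_scale)
  then have "N ((r / N ?p) *\<^sub>R ?p) = r" using \<open>0 < N ?p\<close> \<open>r > 0\<close>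
    by (metis abs_of_pos divide_pos_pos less_irrefl nonzero_eq_divide_eq)
  moreover have "wedge u ((r / N ?p) *\<^sub>R ?p) \<noteq> 0"
    unfolding wedge_simps using \<open>wedge u ?p \<noteq> 0\<close> \<open>0 < N ?p\<close> \<open>r > 0\<close>
    by (metis divide_pos_pos less_irrefl mult_eq_0_iff)
  ultimately show ?thesis using that by blast
qed

lemma ex_minimal_arc:
  assumes "r > 0" "N (u - x) = r" "N (v - x) = r" "u \<noteq> v"
  obtains A where "minimal_arc N x r u v A"
proof (cases "wedge (u - x) (v - x) = 0")
  case True
  then have "v - x = - (u - x)"
    using not_parallel_on_circle[of r "u - x" "v - x"] assms by simp
  then have v: "x - (u - x) = v" by (simp add: algebra_simps)
  have "u - x \<noteq> 0" using assms by auto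
  then obtain y where "N y = r" "wedge (u - x) y \<noteq> 0"
    using ex_independent_on_circle assms by blast
  then obtain A where "minimal_arc N x r (x + (u - x)) (x - (u - x)) A"
    using half_circle_arc assms by blast
  then show ?thesis using that v by simp
next
  case False
  then obtain A where "minimal_arc N x r (x + (u - x)) (x + (v - x)) A"
    using sector_arc assms by blast
  then show ?thesis using that by simp
qed

text \<open>
  Run along the circle around \<open>u\<close> from its point in the direction of \<open>v\<close> to the opposite point. The
  distance to \<open>v\<close> starts at most \<open>r\<close> and ends above \<open>r\<close>, so it takes the value \<open>r\<close>
  in between.
\<close>
lemma ex_common_circle:
  assumes r: "r > 0" and le: "N (u - v) \<le> 2 * r"
  obtains x where "N (u - x) = r" "N (v - x) = r"
proof (cases "u = v")
  case True
  obtain y where "N y = r"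
    using ex_independent_on_circle[OF r, of "axis 1 1"] by (auto simp: axis_eq_0_iff)
  then have "N (u - (u - y)) = r" by simp
  then show ?thesis using that True by blast
next
  case False
  define d where "d = N (v - u)"
  have d: "0 < d" "d \<le> 2 * r"
    using False le by (auto simp: d_def N_minus_commute)
  define e where "e = (r / d) *\<^sub>R (v - u)"
  have e: "N e = r" "e \<noteq> 0" using d r False by (auto simp: e_def N_scale d_def)
  have e_opposite: "u + e \<noteq> u - e"
  proof
    assume "u + e = u - e"
    then have "2 *\<^sub>R e = 0" by (simp add: scaleR_2 algebra_simps)
    then show False using e by simp
  qed
  obtain A where "minimal_arc N u r (u + e) (u - e) A"
    using ex_minimal_arc[of r "u + e" u "u - e"] r e e_opposite by auto
  then obtain g where g: "path g" "g 0 = u + e" "g 1 = u - e" "g ` {0..1} \<subseteq> circle N u r"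
    unfolding minimal_arc_def circular_arc_def arc_def pathstart_def pathfinish_def path_image_def
    by blast
  have "v - (u + e) = (1 - r / d) *\<^sub>R (v - u)" "v - (u - e) = (1 + r / d) *\<^sub>R (v - u)"
    by (simp_all add: e_def algebra_simps)
  then have "N (v - g 0) = \<bar>1 - r / d\<bar> * d" "N (v - g 1) = \<bar>1 + r / d\<bar> * d"
    by (simp_all add: g d_def N_scale)
  moreover have "\<bar>1 - r / d\<bar> * d = \<bar>d - r\<bar>" "\<bar>1 + r / d\<bar> * d = d + r"
    using d r by (simp_all add: abs_if field_simps)
  ultimately have "N (v - g 0) = \<bar>d - r\<bar>" "N (v - g 1) = d + r" by simp_all
  then have "N (v - g 0) \<le> r" "r \<le> N (v - g 1)" using d by auto
  moreover have "continuous_on {0..1} (\<lambda>t. N (v - g t))"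
    using g(1) unfolding path_def by (intro continuous_intros)
  ultimately obtain t where "0 \<le> t" "t \<le> 1" "N (v - g t) = r"
    using IVT'[of "\<lambda>t. N (v - g t)" 0 r 1] by auto
  moreover have "N (u - g t) = r"
    using g(4) \<open>0 \<le> t\<close> \<open>t \<le> 1\<close> by (force simp: circle_def N_minus_commute)
  ultimately show ?thesis using that by blast
qed

section \<open>Minimal arcs lie in every disc through their end points\<close>
lemma minimal_arc_on_circle:
  assumes "minimal_arc N x r u v A"
  shows "u \<in> A" "v \<in> A" "u \<noteq> v" "\<And>y. y \<in> A \<Longrightarrow> N (y - x) = r"
proof -
  obtain g where g: "arc g" "pathstart g = u" "pathfinish g = v" "path_image g = A" "A \<subseteq> circle N x r"
    using assms unfolding minimal_arc_def circular_arc_def by blast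
  then show "u \<in> A" "v \<in> A" by auto
  show "u \<noteq> v" using arc_distinct_ends[OF g(1)] g(2,3) by simp
  show "N (y - x) = r" if "y \<in> A" for y using g(5) that by (auto simp: circle_def)
qed
text \<open>
  A point of the arc outside the cone, say with negative coordinate along \<open>v\<close>, would force the arc to
  meet the line through \<open>x\<close> and \<open>u\<close> again on its way to \<open>v\<close>. In the given half-plane this line meets
  the circle only in \<open>u\<close>, where the arc started. So injectivity of the path suffices, and segments
  contained in the circle need no separate treatment.
\<close>
lemma arc_in_sector:
  assumes r: "r > 0" and arc: "circular_arc N x r u v A"
    and half: "a \<bullet> u = b" "a \<bullet> v = b" "A \<subseteq> {y. b \<le> a \<bullet> y}" "a \<bullet> x < b"
    and y: "y \<in> A"
  obtains \<alpha> \<beta> where "wedge (u - x) (v - x) \<noteq> 0" "y - x = \<alpha> *\<^sub>R (u - x) + \<beta> *\<^sub>R (v - x)"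
    "0 \<le> \<alpha>" "0 \<le> \<beta>" "1 \<le> \<alpha> + \<beta>"
proof -
  have first: "wedge (u - x) (v - x) \<noteq> 0 \<and> 0 \<le> wedge (u - x) (y - x) / wedge (u - x) (v - x)"
    if arc: "circular_arc N x r u v A" and au: "a \<bullet> u = b" and av: "a \<bullet> v = b" for u v
  proof -
    obtain g where g: "arc g" "g 0 = u" "g 1 = v" "g ` {0..1} = A"
      using arc unfolding circular_arc_def pathstart_def pathfinish_def path_image_def by blast
    have circ: "N (g t - x) = r" if "t \<in> {0..1}" for t
      using arc g(4) that unfolding circular_arc_def circle_def by blast
    have ray: "g t = u" if t: "t \<in> {0..1}" and w: "wedge (u - x) (g t - x) = 0" for t
    proof (rule ccontr)
      assume "g t \<noteq> u"
      then have "g t - x = - (u - x)"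
        using not_parallel_on_circle[of r "u - x" "g t - x"] circ[OF t] circ[of 0] g(2) r w by simp
      then have "a \<bullet> (g t - x) = - (a \<bullet> (u - x))" by (metis inner_minus_right)
      moreover have "b \<le> a \<bullet> g t" using half(3) t g(4) by blast
      ultimately show False using au half(4) by (simp add: inner_diff_right)
    qed
    have "u \<noteq> v" using g(1-3) unfolding arc_def by (metis atLeastAtMost_iff inj_on_contraD order_refl zero_le_one zero_neq_one)
    then have nz: "wedge (u - x) (v - x) \<noteq> 0" using ray[of 1] g(3) by auto
    define \<beta> where "\<beta> t = wedge (u - x) (g t - x) / wedge (u - x) (v - x)" for t
    obtain s where s: "s \<in> {0..1}" "g s = y" using y g(4) by blast
    have "0 \<le> \<beta> s"
    proof (rule ccontr)
      assume "\<not> 0 \<le> \<beta> s"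
      moreover have "\<beta> 1 = 1" using nz by (simp add: \<beta>_def g(3))
      moreover have "continuous_on {s..1} g"
        using g(1) s(1) unfolding arc_def path_def by (auto intro: continuous_on_subset)
      then have "continuous_on {s..1} \<beta>"
        unfolding \<beta>_def by (intro continuous_intros) (use nz in auto)
      ultimately obtain t where t: "s \<le> t" "t \<le> 1" "\<beta> t = 0"
        using IVT'[of \<beta> s 0 1] s(1) by auto
      then have "g t = g 0" using ray[of t] s(1) nz g(2) by (simp add: \<beta>_def)
      then have "t = 0" using g(1) t s(1) by (auto simp: arc_def inj_on_def)
      then have "\<beta> s = 0" using t s by auto
      then show False using \<open>\<not> 0 \<le> \<beta> s\<close> by simp
    qed
    then show ?thesis using nz s(2) by (simp add: \<beta>_def)
  qed
  \<comment> \<open>Reversing the path turns the argument for one coordinate into that for the other.\<close>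
  have rev: "circular_arc N x r v u A"
  proof -
    obtain g where "arc g" "pathstart g = u" "pathfinish g = v" "path_image g = A"
      using arc unfolding circular_arc_def by blast
    then have "arc (reversepath g)" "pathstart (reversepath g) = v" "pathfinish (reversepath g) = u"
      "path_image (reversepath g) = A" by (auto simp: arc_reversepath)
    then show ?thesis using arc unfolding circular_arc_def by blast
  qed
  define \<alpha> where "\<alpha> = wedge (y - x) (v - x) / wedge (u - x) (v - x)"
  define \<beta> where "\<beta> = wedge (u - x) (y - x) / wedge (u - x) (v - x)"
  have nz: "wedge (u - x) (v - x) \<noteq> 0" and \<beta>: "0 \<le> \<beta>"
    using first[OF arc half(1,2)] by (auto simp: \<beta>_def)
  have "0 \<le> wedge (v - x) (y - x) / wedge (v - x) (u - x)"
    using first[OF rev half(2,1)] by blast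
  then have \<alpha>: "0 \<le> \<alpha>"
    using wedge_commute[of "v - x" "y - x"] wedge_commute[of "v - x" "u - x"]
    unfolding \<alpha>_def by (simp del: wedge_simps)
  have y_eq: "y - x = \<alpha> *\<^sub>R (u - x) + \<beta> *\<^sub>R (v - x)"
    using wedge_expansion[OF nz] by (simp add: \<alpha>_def \<beta>_def del: wedge_simps)
  have "b - a \<bullet> x \<le> a \<bullet> (y - x)" using half(3) y by (auto simp: inner_diff_right)
  also have "\<dots> = (\<alpha> + \<beta>) * (b - a \<bullet> x)"
    unfolding y_eq using half(1,2) by (simp add: inner_add_right inner_diff_right algebra_simps)
  finally have "1 \<le> \<alpha> + \<beta>" using half(4) by simp
  then show ?thesis using that nz y_eq \<alpha> \<beta> by blast
qed

text \<open>
  This is the inclusion of the arc in a disc through its end points, with the centre of the arc at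
  the origin: \<open>y\<close> is a point of the arc and \<open>z\<close> the centre of the other disc. Write
  \<open>z = \<sigma> u + \<tau> v\<close>.

  If \<open>\<sigma>\<close> or \<open>\<tau>\<close> is positive, the line through \<open>y\<close> in direction \<open>z\<close> meets the segment from \<open>u\<close> to \<open>v\<close>
  in a point \<open>m\<close>. Otherwise it would leave the cone first, and a combination of \<open>y\<close> with \<open>u - z\<close> or
  \<open>v - z\<close> would be a multiple of \<open>u\<close> or \<open>v\<close> outside the disc. Then \<open>y - z\<close> is a convex
  combination of \<open>m\<close> with \<open>y\<close> or with \<open>m - z\<close>, which are all in the disc.

  If \<open>\<sigma>\<close> and \<open>\<tau>\<close> are both nonpositive and \<open>z \<noteq> 0\<close>, then \<open>u - z\<close> and \<open>v - z\<close> are pushed away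
  from the origin. They stay in the disc only if they move parallel to \<open>u + v\<close> along opposite
  segments of the circle, and this is what \<open>wide\<close> excludes.
\<close>
lemma sector_in_disc:
  assumes r: "r > 0" and Nu: "N u = r" and Nv: "N v = r"
    and wide: "strictly_convex N \<or> N (u - v) \<le> r" and indep: "wedge u v \<noteq> 0"
    and y: "y = \<alpha> *\<^sub>R u + \<beta> *\<^sub>R v" "0 \<le> \<alpha>" "0 \<le> \<beta>" "1 \<le> \<alpha> + \<beta>" "N y \<le> r"
    and z: "N (u - z) \<le> r" "N (v - z) \<le> r"
  shows "N (y - z) \<le> r"
proof -
  have ascending: "N (y - z) \<le> r"
    if z_eq: "z = \<sigma> *\<^sub>R u + \<tau> *\<^sub>R v" and \<sigma>: "0 \<le> \<sigma>"
      and sgn: "0 \<le> \<tau> \<or> \<tau> < 0 \<and> 0 < \<sigma>"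
      and Nu: "N u = r" and Nv: "N v = r"
      and y: "y = \<alpha> *\<^sub>R u + \<beta> *\<^sub>R v" "0 \<le> \<alpha>" "0 \<le> \<beta>" "1 \<le> \<alpha> + \<beta>"
      and z: "N (u - z) \<le> r" "N (v - z) \<le> r"
    for u v \<alpha> \<beta> \<sigma> \<tau>
  proof -
    have multiple: "k \<le> m" if "N (k *\<^sub>R w) \<le> m * r" "N w = r" for k m :: real and w
    proof -
      have "\<bar>k\<bar> * r \<le> m * r" using that by (simp add: N_scale)
      then have "\<bar>k\<bar> \<le> m" using r by simp
      then show ?thesis by simp
    qed
    \<comment> \<open>\<open>E1\<close> and \<open>E2\<close> say that the two coordinates of \<open>m\<close> below are nonnegative.\<close>
    have E1: "\<sigma> * (\<beta> - 1) \<le> \<alpha> * \<tau>"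
    proof -
      have "N (\<sigma> *\<^sub>R y + \<alpha> *\<^sub>R (v - z)) \<le> (\<sigma> + \<alpha>) * r"
        by (rule N_combination_le) (use \<sigma> y \<open>N y \<le> r\<close> z in auto)
      moreover have "\<sigma> *\<^sub>R y + \<alpha> *\<^sub>R (v - z) = (\<sigma> * \<beta> + \<alpha> - \<alpha> * \<tau>) *\<^sub>R v"
        by (simp add: y(1) z_eq algebra_simps)
      ultimately have "\<sigma> * \<beta> + \<alpha> - \<alpha> * \<tau> \<le> \<sigma> + \<alpha>"
        using multiple Nv by metis
      then show ?thesis by (simp add: algebra_simps)
    qed
    have E2: "\<tau> * (\<alpha> - 1) \<le> \<beta> * \<sigma>" and pos: "0 \<le> \<sigma> + \<tau>"
    proof -
      have "\<tau> * (\<alpha> - 1) \<le> \<beta> * \<sigma> \<and> 0 \<le> \<sigma> + \<tau>"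
      proof (cases "0 \<le> \<tau>")
        case True
        have "N (\<tau> *\<^sub>R y + \<beta> *\<^sub>R (u - z)) \<le> (\<tau> + \<beta>) * r"
          by (rule N_combination_le) (use True y \<open>N y \<le> r\<close> z in auto)
        moreover have "\<tau> *\<^sub>R y + \<beta> *\<^sub>R (u - z) = (\<tau> * \<alpha> + \<beta> - \<beta> * \<sigma>) *\<^sub>R u"
          by (simp add: y(1) z_eq algebra_simps)
        ultimately have "\<tau> * \<alpha> + \<beta> - \<beta> * \<sigma> \<le> \<tau> + \<beta>"
          using multiple Nu by metis
        then show ?thesis using True \<sigma> by (simp add: algebra_simps)
      next
        case False
        have "N (\<sigma> *\<^sub>R u + 1 *\<^sub>R (v - z)) \<le> (\<sigma> + 1) * r"
          by (rule N_combination_le) (use \<sigma> Nu z in auto)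
        moreover have "\<sigma> *\<^sub>R u + 1 *\<^sub>R (v - z) = (1 - \<tau>) *\<^sub>R v"
          by (simp add: z_eq algebra_simps)
        ultimately have "1 - \<tau> \<le> \<sigma> + 1"
          using multiple Nv by metis
        then have le: "- \<tau> \<le> \<sigma>" by simp
        have "0 \<le> (- \<tau>) * (\<alpha> + \<beta> - 1)" using False y by (intro mult_nonneg_nonneg) auto
        moreover have "\<beta> * (- \<tau>) \<le> \<beta> * \<sigma>" using le y by (intro mult_left_mono)
        ultimately show ?thesis using le by (simp add: algebra_simps)
      qed
      then show "\<tau> * (\<alpha> - 1) \<le> \<beta> * \<sigma>" "0 \<le> \<sigma> + \<tau>" by auto
    qed
    show ?thesis
    proof (cases "\<sigma> + \<tau> = 0")
      case True
      show ?thesis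
      proof (cases "\<sigma> = 0")
        case True
        then show ?thesis using \<open>\<sigma> + \<tau> = 0\<close> z_eq \<open>N y \<le> r\<close> by simp
      next
        case False
        have "\<tau> = - \<sigma>" using True by simp
        then have "\<sigma> * (\<alpha> + \<beta> - 1) \<le> 0" using E1 by (simp add: algebra_simps)
        then have "\<alpha> + \<beta> = 1" using False \<sigma> y by (simp add: mult_le_0_iff)
        then have "y - z = \<alpha> *\<^sub>R (u - z) + \<beta> *\<^sub>R (v - z)"
          using scaleR_add_left[of \<alpha> \<beta> z] by (simp add: y(1) algebra_simps)
        moreover have "N \<dots> \<le> (\<alpha> + \<beta>) * r" using y z by (intro N_combination_le)
        ultimately show ?thesis using \<open>\<alpha> + \<beta> = 1\<close> by simp
      qed
    next
      case False
      then have s: "0 < \<sigma> + \<tau>" using pos by simp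
      \<comment> \<open>The value of \<open>c\<close> puts \<open>m\<close> on the line through \<open>u\<close> and \<open>v\<close>.\<close>
      define c where "c = (\<alpha> + \<beta> - 1) / (\<sigma> + \<tau>)"
      define m where "m = y - c *\<^sub>R z"
      define a where "a = \<alpha> - c * \<sigma>"
      define b where "b = \<beta> - c * \<tau>"
      have c0: "0 \<le> c" using y s by (simp add: c_def)
      have cs: "c * (\<sigma> + \<tau>) = \<alpha> + \<beta> - 1" using s by (simp add: c_def)
      have a: "a * (\<sigma> + \<tau>) = \<alpha> * \<tau> - \<sigma> * (\<beta> - 1)"
      proof -
        have "a * (\<sigma> + \<tau>) = \<alpha> * (\<sigma> + \<tau>) - \<sigma> * (c * (\<sigma> + \<tau>))"
          by (simp add: a_def algebra_simps)
        then show ?thesis unfolding cs by (simp add: algebra_simps)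
      qed
      have b: "b * (\<sigma> + \<tau>) = \<beta> * \<sigma> - \<tau> * (\<alpha> - 1)"
      proof -
        have "b * (\<sigma> + \<tau>) = \<beta> * (\<sigma> + \<tau>) - \<tau> * (c * (\<sigma> + \<tau>))"
          by (simp add: b_def algebra_simps)
        then show ?thesis unfolding cs by (simp add: algebra_simps)
      qed
      have "0 \<le> a * (\<sigma> + \<tau>)" "0 \<le> b * (\<sigma> + \<tau>)" using a b E1 E2 by auto
      then have ab: "0 \<le> a" "0 \<le> b" using s by (auto simp: zero_le_mult_iff)
      have ab1: "a + b = 1" using cs by (simp add: a_def b_def algebra_simps)
      have m: "m = a *\<^sub>R u + b *\<^sub>R v"
        by (simp add: m_def a_def b_def y(1) z_eq algebra_simps)
      have Nm: "N m \<le> r"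
        using N_combination_le[of u r v a b] ab ab1 Nu Nv m by simp
      have mz: "m - z = a *\<^sub>R (u - z) + b *\<^sub>R (v - z)"
      proof -
        have "a *\<^sub>R z + b *\<^sub>R z = z" using ab1 by (simp flip: scaleR_add_left)
        then show ?thesis by (simp add: m algebra_simps)
      qed
      have Nmz: "N (m - z) \<le> r"
        using N_combination_le[of "u - z" r "v - z" a b] ab ab1 z mz by simp
      show ?thesis
      proof (cases "c \<le> 1")
        case True
        have "y - z = c *\<^sub>R m + (1 - c) *\<^sub>R (m - z)"
          by (simp add: m_def algebra_simps)
        moreover have "N \<dots> \<le> (c + (1 - c)) * r"
          using True c0 Nm Nmz by (intro N_combination_le) auto
        ultimately show ?thesis by simp
      next
        case False
        have "y - z = (1 - 1/c) *\<^sub>R y + (1/c) *\<^sub>R m"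
          using False by (simp add: m_def algebra_simps)
        moreover have "N \<dots> \<le> ((1 - 1/c) + 1/c) * r"
          using False Nm \<open>N y \<le> r\<close> by (intro N_combination_le) auto
        ultimately show ?thesis by simp
      qed
    qed
  qed
  define \<sigma> where "\<sigma> = wedge z v / wedge u v"
  define \<tau> where "\<tau> = wedge u z / wedge u v"
  have z_eq: "z = \<sigma> *\<^sub>R u + \<tau> *\<^sub>R v"
    using wedge_expansion[OF indep] by (simp add: \<sigma>_def \<tau>_def)
  have swap: "z = \<tau> *\<^sub>R v + \<sigma> *\<^sub>R u" "y = \<beta> *\<^sub>R v + \<alpha> *\<^sub>R u" "1 \<le> \<beta> + \<alpha>"
    using z_eq y by (simp_all add: add.commute)
  consider "0 \<le> \<sigma>" "0 \<le> \<tau> \<or> \<tau> < 0 \<and> 0 < \<sigma>" | "0 \<le> \<tau>" "0 \<le> \<sigma> \<or> \<sigma> < 0 \<and> 0 < \<tau>" | "\<sigma> \<le> 0" "\<tau> \<le> 0"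
    by linarith
  then show ?thesis
  proof cases
    case 1
    then show ?thesis using ascending[OF z_eq _ _ Nu Nv] y z by blast
  next
    case 2
    then show ?thesis using ascending[OF swap(1) _ _ Nv Nu swap(2)] y z swap by blast
  next
    case 3
    define s where "s = - \<sigma>"
    define t where "t = - \<tau>"
    have st: "0 \<le> s" "0 \<le> t" using 3 by (auto simp: s_def t_def)
    have z_st: "z = - (s *\<^sub>R u) - t *\<^sub>R v" by (simp add: s_def t_def z_eq)
    have "N ((1 + s + t) *\<^sub>R u) \<le> ((1 + t) + t) * r"
    proof -
      have "(1 + s + t) *\<^sub>R u = (1 + t) *\<^sub>R (u - z) + t *\<^sub>R (- (v - z))"
        by (simp add: z_st algebra_simps)
      moreover have "N \<dots> \<le> ((1 + t) + t) * r"
        using st z by (intro N_combination_le) (auto simp del: minus_diff_eq)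
      ultimately show ?thesis by simp
    qed
    then have "s \<le> t" using r st by (simp add: N_scale Nu)
    moreover have "N ((1 + s + t) *\<^sub>R v) \<le> ((1 + s) + s) * r"
    proof -
      have "(1 + s + t) *\<^sub>R v = (1 + s) *\<^sub>R (v - z) + s *\<^sub>R (- (u - z))"
        by (simp add: z_st algebra_simps)
      moreover have "N \<dots> \<le> ((1 + s) + s) * r"
        using st z by (intro N_combination_le) (auto simp del: minus_diff_eq)
      ultimately show ?thesis by simp
    qed
    then have "t \<le> s" using r st by (simp add: N_scale Nv)
    ultimately have "t = s" by simp
    show ?thesis
    proof (cases "s = 0")
      case True
      then show ?thesis using \<open>t = s\<close> z_st y by simp
    next
      case False
      have "(1 + 2 * s) *\<^sub>R u = (u - z) + s *\<^sub>R (u - v)"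
        by (simp add: z_st \<open>t = s\<close> scaleR_add_left scaleR_diff_right scaleR_2 flip: scaleR_scaleR)
      then have "(1 + 2 * s) * r \<le> r + s * N (u - v)"
        using N_triangle[of "u - z" "s *\<^sub>R (u - v)"] st z(1) N_scale[of "1 + 2 * s" u]
        by (simp add: N_scale Nu)
      then have "s * (2 * r) \<le> s * N (u - v)" by (simp add: algebra_simps)
      then have far: "2 * r \<le> N (u - v)" using False st by simp
      then have "strictly_convex N" using wide r by auto
      then have "u = - v"
        using strictly_convex_sum_eq[of r u "- v"] r Nu Nv far by simp
      then show ?thesis using indep by simp
    qed
  qed
qed
text \<open>
  If the end points are not opposite, this is \<open>sector_in_disc\<close>. If they are, the disc of the arc is the only
  one of this radius that contains both of them.
\<close>
lemma minimal_arc_in_disc: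
  assumes r: "r > 0" and arc: "minimal_arc N x r u v A"
    and wide: "strictly_convex N \<or> N (u - v) \<le> r"
    and z: "u \<in> disc N z r" "v \<in> disc N z r"
  shows "A \<subseteq> disc N z r"
proof
  fix y assume y: "y \<in> A"
  obtain a b where ab: "circular_arc N x r u v A" "a \<bullet> u = b" "a \<bullet> v = b" "A \<subseteq> {y. b \<le> a \<bullet> y}"
      "x \<notin> {y. b \<le> a \<bullet> y} \<or> x = midpoint u v"
    using arc unfolding minimal_arc_def by blast
  note ends = minimal_arc_on_circle(1,2)[OF arc] and on = minimal_arc_on_circle(4)[OF arc]
  show "y \<in> disc N z r"
  proof (cases "x = midpoint u v")
    case False
    then have "a \<bullet> x < b" using ab(5) by auto
    then obtain \<alpha> \<beta> where "wedge (u - x) (v - x) \<noteq> 0" "y - x = \<alpha> *\<^sub>R (u - x) + \<beta> *\<^sub>R (v - x)"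
        "0 \<le> \<alpha>" "0 \<le> \<beta>" "1 \<le> \<alpha> + \<beta>"
      using arc_in_sector[OF r ab(1-4) _ y] by blast
    then have "N ((y - x) - (z - x)) \<le> r"
      using sector_in_disc[of r "u - x" "v - x" "y - x" \<alpha> \<beta> "z - x"] r wide on[OF ends(1)] on[OF ends(2)] on[OF y] z
      by (simp add: disc_def)
    then show ?thesis by (simp add: disc_def)
  next
    case True
    have mid: "x = (1/2) *\<^sub>R (u + v)" by (simp add: True midpoint_def)
    then have uv: "u - v = 2 *\<^sub>R (u - x)" by (simp add: scaleR_diff_right scaleR_add_right scaleR_2)
    then have far: "N (u - v) = 2 * r" using on[OF ends(1)] by (simp add: N_scale)
    then have "strictly_convex N" using wide r by simp
    then have "z = x"
      using opposite_center_unique[OF _ r far] z True by (simp add: disc_def)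
    then show ?thesis using on[OF y] by (simp add: disc_def)
  qed
qed

section \<open>Compactness of the union of the minimal arcs\<close>
lemma union_opposite_minimal_arcs:
  assumes sc: "strictly_convex N" and r: "r > 0" and uv: "N (u - v) = 2 * r"
  shows "\<Union>(minimal_arcs N r u v) = circle N (midpoint u v) r"
proof
  show "\<Union>(minimal_arcs N r u v) \<subseteq> circle N (midpoint u v) r"
  proof
    fix y assume "y \<in> \<Union>(minimal_arcs N r u v)"
    then obtain x A where A: "minimal_arc N x r u v A" "y \<in> A"
      unfolding minimal_arcs_def by blast
    note on = minimal_arc_on_circle[OF A(1)]
    have "x = midpoint u v"
      using opposite_center_unique[OF sc r uv] on(4)[OF on(1)] on(4)[OF on(2)] by simp
    then show "y \<in> circle N (midpoint u v) r" using on(4)[OF A(2)] by (simp add: circle_def)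
  qed
  show "circle N (midpoint u v) r \<subseteq> \<Union>(minimal_arcs N r u v)"
  proof
    define m where "m = midpoint u v"
    define e where "e = u - m"
    have "2 *\<^sub>R m = u + v" by (simp add: m_def midpoint_def)
    then have v: "v = m - e" by (simp add: e_def scaleR_2 algebra_simps)
    have u: "u = m + e" by (simp add: e_def)
    have "u - v = 2 *\<^sub>R e" by (simp add: u v scaleR_2)
    then have e: "N e = r" using uv by (simp add: N_scale)
    fix y assume "y \<in> circle N (midpoint u v) r"
    then have y: "N (y - m) = r" by (simp add: circle_def m_def)
    show "y \<in> \<Union>(minimal_arcs N r u v)"
    proof (cases "wedge e (y - m) = 0")
      case False
      then obtain A where "minimal_arc N m r (m + e) (m - e) A" "m + (y - m) \<in> A"
        using half_circle_arc[OF r e y] by metis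
      then have "minimal_arc N m r u v A" "y \<in> A" using u v by simp_all
      then show ?thesis unfolding minimal_arcs_def by blast
    next
      case True
      then have "y - m = e \<or> y - m = - e"
        using not_parallel_on_circle[OF r e y] by metis
      then have y: "y = u \<or> y = v" by (auto simp: u v algebra_simps)
      have "N (u - m) = r" "N (v - m) = r" using e by (simp_all add: u v)
      moreover have "u \<noteq> v" using uv r by auto
      ultimately obtain A where A: "minimal_arc N m r u v A"
        using ex_minimal_arc[OF r] by metis
      then have "y \<in> A" using minimal_arc_on_circle[OF A] y by blast
      then show ?thesis using A unfolding minimal_arcs_def by blast
    qed
  qed
qed

text \<open>
  The cone condition is expressed by signs of determinants instead of the existence of coordinates.
  In this form it is a closed condition on the pair \<open>(x, y)\<close>.
\<close>
lemma union_minimal_arcs_sector: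
  assumes r: "r > 0" and uv: "u \<noteq> v" "N (u - v) \<noteq> 2 * r"
  shows "\<Union>(minimal_arcs N r u v) =
    {y. \<exists>x. N (u - x) = r \<and> N (v - x) = r \<and> N (y - x) = r \<and>
        0 \<le> wedge (y - x) (v - x) * wedge (u - x) (v - x) \<and>
        0 \<le> wedge (u - x) (y - x) * wedge (u - x) (v - x)}"
    (is "_ = ?S")
proof
  show "\<Union>(minimal_arcs N r u v) \<subseteq> ?S"
  proof
    fix y assume "y \<in> \<Union>(minimal_arcs N r u v)"
    then obtain x A where A: "minimal_arc N x r u v A" "y \<in> A"
      unfolding minimal_arcs_def by blast
    note on = minimal_arc_on_circle[OF A(1)]
    have "x \<noteq> midpoint u v"
    proof
      assume "x = midpoint u v"
      then have "u - v = 2 *\<^sub>R (u - x)"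
        by (simp add: midpoint_def scaleR_diff_right scaleR_add_right scaleR_2)
      then have "N (u - v) = 2 * r" using on(4)[OF on(1)] by (simp add: N_scale)
      then show False using uv by simp
    qed
    then obtain a b where ab: "circular_arc N x r u v A" "a \<bullet> u = b" "a \<bullet> v = b"
        "A \<subseteq> {y. b \<le> a \<bullet> y}" "a \<bullet> x < b"
      using A(1) unfolding minimal_arc_def by auto
    obtain \<alpha> \<beta> where y: "y - x = \<alpha> *\<^sub>R (u - x) + \<beta> *\<^sub>R (v - x)" "0 \<le> \<alpha>" "0 \<le> \<beta>"
      using arc_in_sector[OF r ab A(2)] by blast
    have "wedge (y - x) (v - x) = \<alpha> * wedge (u - x) (v - x)"
      unfolding y(1) wedge_simps(2,8) by (simp only: wedge_simps(1) mult_zero_right add_0_right)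
    moreover have "wedge (u - x) (y - x) = \<beta> * wedge (u - x) (v - x)"
      unfolding y(1) wedge_simps(3,9) by (simp only: wedge_simps(1) mult_zero_right add_0_left)
    ultimately have "0 \<le> wedge (y - x) (v - x) * wedge (u - x) (v - x)"
      "0 \<le> wedge (u - x) (y - x) * wedge (u - x) (v - x)"
      using y(2,3) by (simp_all only: mult.assoc) (simp_all only: mult_nonneg_nonneg zero_le_square)
    then show "y \<in> ?S" using on(4)[OF on(1)] on(4)[OF on(2)] on(4)[OF A(2)] by blast
  qed
  show "?S \<subseteq> \<Union>(minimal_arcs N r u v)"
  proof
    fix y assume "y \<in> ?S"
    then obtain x where x: "N (u - x) = r" "N (v - x) = r" "N (y - x) = r"
        "0 \<le> wedge (y - x) (v - x) * wedge (u - x) (v - x)"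
        "0 \<le> wedge (u - x) (y - x) * wedge (u - x) (v - x)" by blast
    have nz: "wedge (u - x) (v - x) \<noteq> 0"
    proof
      assume "wedge (u - x) (v - x) = 0"
      then have "v - x = - (u - x)"
        using not_parallel_on_circle[OF r x(1,2)] uv(1) by auto
      then have "v = 2 *\<^sub>R x - u" by (simp add: scaleR_2 algebra_simps)
      then have "u - v = 2 *\<^sub>R (u - x)" by (simp add: scaleR_diff_right scaleR_2)
      then have "N (u - v) = 2 * r" using x(1) by (simp add: N_scale)
      then show False using uv(2) by simp
    qed
    define \<alpha> where "\<alpha> = wedge (y - x) (v - x) / wedge (u - x) (v - x)"
    define \<beta> where "\<beta> = wedge (u - x) (y - x) / wedge (u - x) (v - x)"
    have y: "y - x = \<alpha> *\<^sub>R (u - x) + \<beta> *\<^sub>R (v - x)"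
      unfolding \<alpha>_def \<beta>_def by (rule wedge_expansion[OF nz])
    have "0 \<le> \<alpha>" "0 \<le> \<beta>"
      using x(4,5) unfolding \<alpha>_def \<beta>_def zero_le_divide_iff zero_le_mult_iff by auto
    then obtain A where "minimal_arc N x r (x + (u - x)) (x + (v - x)) A" "x + (y - x) \<in> A"
      using sector_arc[OF r x(1,2) nz] x(3) unfolding y by metis
    then have "minimal_arc N x r u v A" "y \<in> A" by simp_all
    then show "y \<in> \<Union>(minimal_arcs N r u v)" unfolding minimal_arcs_def by blast
  qed
qed

text \<open>
  Without strict convexity there may be infinitely many circles through \<open>u\<close> and \<open>v\<close>. Their centres
  form a compact set, and the union of the arcs is a projection of a closed set along it.
\<close>
lemma compact_union_minimal_arcs:
  assumes r: "r > 0" and "u \<noteq> v" and wide: "strictly_convex N \<or> N (u - v) \<le> r"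
  shows "compact (\<Union>(minimal_arcs N r u v))"
proof (cases "N (u - v) = 2 * r")
  case True
  then have "strictly_convex N" using wide r by simp
  then show ?thesis using union_opposite_minimal_arcs[OF _ r True] compact_circle by simp
next
  case False
  define T where "T = {p :: plane \<times> plane. N (v - fst p) = r \<and> N (snd p - fst p) = r \<and>
        0 \<le> wedge (snd p - fst p) (v - fst p) * wedge (u - fst p) (v - fst p) \<and>
        0 \<le> wedge (u - fst p) (snd p - fst p) * wedge (u - fst p) (v - fst p)}"
  have eq: "\<Union>(minimal_arcs N r u v) = {y. \<exists>x. x \<in> circle N u r \<and> (x, y) \<in> T}"
    unfolding union_minimal_arcs_sector[OF r \<open>u \<noteq> v\<close> False] T_def circle_def
    using N_minus_commute[of u] by auto
  have "closed T"
    unfolding T_def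
    by (intro closed_Collect_conj closed_Collect_eq closed_Collect_le continuous_intros)
  then have "closed (\<Union>(minimal_arcs N r u v))"
    unfolding eq by (rule closed_compact_projection[OF compact_circle])
  moreover have "\<Union>(minimal_arcs N r u v) \<subseteq> disc N u (2 * r)"
  proof
    fix y assume "y \<in> \<Union>(minimal_arcs N r u v)"
    then obtain x where "N (x - u) = r" "N (y - x) = r"
      unfolding eq T_def circle_def by auto
    then show "y \<in> disc N u (2 * r)"
      using N_triangle[of "y - x" "x - u"] by (simp add: disc_def)
  qed
  ultimately show ?thesis using compact_disc closed_Int_compact by (metis inf.absorb_iff1)
qed
section \<open>The highest point of an extremal disc\<close>
lemma support_on_circle:
  assumes r: "r > 0" and "\<phi> \<noteq> 0" "N u \<le> r" and max: "\<And>y. N y \<le> r \<Longrightarrow> \<phi> \<bullet> y \<le> \<phi> \<bullet> u"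
  shows "N u = r"
proof (rule ccontr)
  assume "N u \<noteq> r"
  then have lt: "N u < r" using \<open>N u \<le> r\<close> by simp
  define t where "t = (r - N u) / N \<phi>"
  have "0 < t" using lt \<open>\<phi> \<noteq> 0\<close> by (simp add: t_def)
  have "N (u + t *\<^sub>R \<phi>) \<le> N u + t * N \<phi>"
    using N_triangle[of u "t *\<^sub>R \<phi>"] \<open>0 < t\<close> by (simp add: N_scale)
  also have "\<dots> = r" using \<open>\<phi> \<noteq> 0\<close> by (simp add: t_def)
  finally have "\<phi> \<bullet> (u + t *\<^sub>R \<phi>) \<le> \<phi> \<bullet> u" by (rule max)
  then have "t * (\<phi> \<bullet> \<phi>) \<le> 0" by (simp add: inner_add_right)
  moreover have "0 < \<phi> \<bullet> \<phi>" using \<open>\<phi> \<noteq> 0\<close> by simp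
  ultimately show False using \<open>0 < t\<close> by (simp add: mult_le_0_iff)
qed

text \<open>
  The maximum of \<open>\<phi>\<close> over the disc is \<open>r\<close> times the dual norm of \<open>\<phi>\<close>.
\<close>

lemma support_bound:
  assumes r: "r > 0" and max: "\<And>y. N y \<le> r \<Longrightarrow> \<phi> \<bullet> y \<le> \<phi> \<bullet> u"
  shows "r * \<bar>\<phi> \<bullet> x\<bar> \<le> (\<phi> \<bullet> u) * N x"
proof -
  have "r * (\<phi> \<bullet> x) \<le> (\<phi> \<bullet> u) * N x" for x
  proof (cases "x = 0")
    case False
    then have "0 < N x" by simp
    then have "N ((r / N x) *\<^sub>R x) \<le> r" using r by (simp add: N_scale)
    then have "\<phi> \<bullet> ((r / N x) *\<^sub>R x) \<le> \<phi> \<bullet> u" by (rule max)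
    then show ?thesis using \<open>0 < N x\<close> by (simp add: pos_divide_le_eq)
  qed simp
  from this[of x] this[of "- x"] show ?thesis by (simp add: abs_if)
qed

text \<open>
  The maximum of \<open>\<phi> + \<psi>\<close> is attained between a maximum point \<open>u\<close> of \<open>\<phi>\<close> and a maximum point \<open>v\<close> of
  \<open>\<psi>\<close>. If a maximum point \<open>w\<close> of the sum had a negative coordinate in the basis \<open>u\<close>, \<open>v\<close>, the triangle
  inequalities between the coordinates would bound its value by the value at \<open>u\<close> or at \<open>v\<close>.
\<close>
lemma sum_of_supports_attained_between:
  assumes r: "r > 0"
    and u: "N u \<le> r" "\<And>y. N y \<le> r \<Longrightarrow> \<phi> \<bullet> y \<le> \<phi> \<bullet> u"
    and v: "N v \<le> r" "\<And>y. N y \<le> r \<Longrightarrow> \<psi> \<bullet> y \<le> \<psi> \<bullet> v"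
    and w: "N w \<le> r" "\<And>y. N y \<le> r \<Longrightarrow> (\<phi> + \<psi>) \<bullet> y \<le> (\<phi> + \<psi>) \<bullet> w"
    and not_u: "(\<phi> + \<psi>) \<bullet> u < (\<phi> + \<psi>) \<bullet> w" and not_v: "(\<phi> + \<psi>) \<bullet> v < (\<phi> + \<psi>) \<bullet> w"
  shows "N u = r \<and> N v = r \<and> N w = r \<and> (v = - u \<or>
    wedge u v \<noteq> 0 \<and> (\<exists>\<alpha> \<beta>. 0 \<le> \<alpha> \<and> 0 \<le> \<beta> \<and> w = \<alpha> *\<^sub>R u + \<beta> *\<^sub>R v))"
proof -
  have "\<phi> \<noteq> 0" using v(2)[OF w(1)] not_v by auto
  moreover have "\<psi> \<noteq> 0" using u(2)[OF w(1)] not_u by auto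
  moreover have "\<phi> + \<psi> \<noteq> 0" using not_u by auto
  ultimately have on: "N u = r" "N v = r" "N w = r"
    using support_on_circle[OF r _ u] support_on_circle[OF r _ v] support_on_circle[OF r _ w] by blast+
  have "u \<noteq> v" using u(2)[OF w(1)] v(2)[OF w(1)] not_u by (auto simp: inner_add_left)
  have "\<exists>\<alpha> \<beta>. 0 \<le> \<alpha> \<and> 0 \<le> \<beta> \<and> w = \<alpha> *\<^sub>R u + \<beta> *\<^sub>R v" if indep: "wedge u v \<noteq> 0"
  proof -
    define a where "a = \<phi> \<bullet> u"
    define b where "b = \<psi> \<bullet> v"
    have bound: "\<bar>\<phi> \<bullet> x\<bar> \<le> a" "\<bar>\<psi> \<bullet> x\<bar> \<le> b" if "N x = r" for x
      using support_bound[OF r u(2), of x] support_bound[OF r v(2), of x] that r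
      by (simp_all add: a_def b_def mult.commute)
    obtain \<alpha> \<beta> where w_eq: "w = \<alpha> *\<^sub>R u + \<beta> *\<^sub>R v"
      using wedge_expansion[OF indep] by blast
    then have tri: "\<bar>1 - \<bar>\<alpha>\<bar>\<bar> \<le> \<bar>\<beta>\<bar>" "\<bar>1 - \<bar>\<beta>\<bar>\<bar> \<le> \<bar>\<alpha>\<bar>"
      using coordinate_bounds_on_circle[of u r v \<alpha> \<beta>] on r by auto
    have val: "\<phi> \<bullet> w = \<alpha> * a + \<beta> * (\<phi> \<bullet> v)" "\<psi> \<bullet> w = \<alpha> * (\<psi> \<bullet> u) + \<beta> * b"
      by (simp_all add: w_eq a_def b_def inner_add_right)
    have \<phi>w: "\<phi> \<bullet> w \<le> a" and \<psi>w: "\<psi> \<bullet> w \<le> b"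
      using bound[OF on(3)] by auto
    consider "\<alpha> < 0" "0 \<le> \<beta>" | "0 \<le> \<alpha>" "\<beta> < 0" | "\<alpha> < 0" "\<beta> < 0" | "0 \<le> \<alpha>" "0 \<le> \<beta>"
      by linarith
    then show ?thesis
    proof cases
      case 1
      have "(\<phi> + \<psi>) \<bullet> w - (\<phi> + \<psi>) \<bullet> v \<le> \<alpha> * a + (\<beta> - 1) * (\<phi> \<bullet> v)"
        using \<psi>w val(1) by (simp add: inner_add_left b_def algebra_simps)
      also have "(\<beta> - 1) * (\<phi> \<bullet> v) \<le> \<bar>\<beta> - 1\<bar> * \<bar>\<phi> \<bullet> v\<bar>"
        by (metis abs_ge_self abs_mult)
      also have "\<dots> \<le> (- \<alpha>) * a"
        using tri(2) 1 bound(1)[OF on(2)] by (intro mult_mono) auto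
      finally show ?thesis using not_v by simp
    next
      case 2
      have "(\<phi> + \<psi>) \<bullet> w - (\<phi> + \<psi>) \<bullet> u \<le> \<beta> * b + (\<alpha> - 1) * (\<psi> \<bullet> u)"
        using \<phi>w val(2) by (simp add: inner_add_left a_def algebra_simps)
      also have "(\<alpha> - 1) * (\<psi> \<bullet> u) \<le> \<bar>\<alpha> - 1\<bar> * \<bar>\<psi> \<bullet> u\<bar>"
        by (metis abs_ge_self abs_mult)
      also have "\<dots> \<le> (- \<beta>) * b"
        using tri(1) 2 bound(2)[OF on(1)] by (intro mult_mono) auto
      finally show ?thesis using not_u by simp
    next
      case 3
      have "\<beta> * (\<phi> \<bullet> v) \<le> (- \<beta>) * a" "\<alpha> * (\<psi> \<bullet> u) \<le> (- \<alpha>) * b"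
        using 3 bound(1)[OF on(2)] bound(2)[OF on(1)] mult_left_mono[of "- (\<phi> \<bullet> v)" a "- \<beta>"]
          mult_left_mono[of "- (\<psi> \<bullet> u)" b "- \<alpha>"] by auto
      then have "(\<phi> + \<psi>) \<bullet> w \<le> (\<alpha> - \<beta>) * (a - b)"
        using val by (simp add: inner_add_left algebra_simps)
      also have "\<dots> \<le> \<bar>a - b\<bar>"
      proof -
        have "\<bar>\<alpha> - \<beta>\<bar> \<le> 1" using tri 3 by linarith
        then have "\<bar>\<alpha> - \<beta>\<bar> * \<bar>a - b\<bar> \<le> 1 * \<bar>a - b\<bar>" by (intro mult_right_mono) auto
        then show ?thesis by (metis abs_ge_self abs_mult mult_1 order_trans)
      qed
      finally have "(\<phi> + \<psi>) \<bullet> w \<le> \<bar>a - b\<bar>" .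
      moreover have "a - b \<le> (\<phi> + \<psi>) \<bullet> u" "b - a \<le> (\<phi> + \<psi>) \<bullet> v"
        using bound(2)[OF on(1)] bound(1)[OF on(2)] by (auto simp: inner_add_left a_def b_def)
      ultimately show ?thesis using not_u not_v by linarith
    next
      case 4
      then show ?thesis using w_eq by blast
    qed
  qed
  then show ?thesis
    using on not_parallel_on_circle[OF r on(1,2) _ \<open>u \<noteq> v\<close>] by blast
qed

text \<open>
  The optimality condition at a centre \<open>z\<close> minimising \<open>f\<close> under two constraints: a nonnegative
  multiple of \<open>f\<close> is a sum of functionals maximised on the disc at the two constraining points. It is
  obtained by separating the origin from the convex set of all \<open>(z1 - z2, f(z1) - f(z) + s)\<close> with
  \<open>z1\<close>, \<open>z2\<close> admissible for one constraint each and \<open>s > 0\<close>; the origin belonging to this set would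
  mean a better centre. The factor \<open>c\<close> may vanish, because the two discs of centres may have no common
  interior point.
\<close>
lemma optimal_center_supports:
  assumes r: "r > 0" and f: "f \<noteq> 0" and z: "N (u - z) \<le> r" "N (v - z) \<le> r"
    and min: "\<And>z'. N (u - z') \<le> r \<Longrightarrow> N (v - z') \<le> r \<Longrightarrow> f \<bullet> z \<le> f \<bullet> z'"
  shows "\<exists>\<phi> \<psi> c. 0 \<le> c \<and> c *\<^sub>R f = \<phi> + \<psi> \<and> (\<phi> \<noteq> 0 \<or> \<psi> \<noteq> 0) \<and>
    (\<forall>y. N y \<le> r \<longrightarrow> \<phi> \<bullet> y \<le> \<phi> \<bullet> (u - z)) \<and> (\<forall>y. N y \<le> r \<longrightarrow> \<psi> \<bullet> y \<le> \<psi> \<bullet> (v - z))"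
proof -
  define L :: "plane \<times> plane \<times> real \<Rightarrow> plane \<times> real"
    where "L = (\<lambda>(z1, z2, s). (z1 - z2, f \<bullet> z1 + s))"
  define S where "S = (+) (0, - (f \<bullet> z)) ` L ` (disc N u r \<times> disc N v r \<times> {0<..})"
  have "linear L"
    by (rule linearI) (auto simp: L_def inner_add_right algebra_simps)
  then have "convex S"
    unfolding S_def by (intro convex_translation convex_linear_image convex_Times convex_disc) auto
  moreover have "0 \<notin> S"
  proof
    assume "0 \<in> S"
    then obtain z' s where "z' \<in> disc N u r" "z' \<in> disc N v r" "0 < s" "f \<bullet> z' + s = f \<bullet> z"
      by (auto simp: S_def L_def zero_prod_def)
    then show False using min[of z'] by (auto simp: disc_def N_minus_commute)
  qed
  ultimately obtain p where p: "p \<noteq> 0" "\<And>x. x \<in> S \<Longrightarrow> 0 \<le> p \<bullet> x"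
    using separating_hyperplane_set_0[of S] by blast
  obtain \<theta> c where [simp]: "p = (\<theta>, c)" by (cases p)
  have S: "0 \<le> \<theta> \<bullet> (z1 - z2) + c * (f \<bullet> z1 - f \<bullet> z + s)"
    if "N (u - z1) \<le> r" "N (v - z2) \<le> r" "0 < s" for z1 z2 s
  proof -
    have "(0, - (f \<bullet> z)) + L (z1, z2, s) \<in> S"
      unfolding S_def using that by (intro imageI) (auto simp: disc_def N_minus_commute)
    from p(2)[OF this] show ?thesis by (simp add: L_def algebra_simps)
  qed
  have "0 \<le> c" using S[OF z, of 1] by simp
  have S0: "0 \<le> \<theta> \<bullet> (z1 - z2) + c * (f \<bullet> z1 - f \<bullet> z)"
    if "N (u - z1) \<le> r" "N (v - z2) \<le> r" for z1 z2
  proof (rule ccontr)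
    define X where "X = \<theta> \<bullet> (z1 - z2) + c * (f \<bullet> z1 - f \<bullet> z)"
    assume "\<not> 0 \<le> \<theta> \<bullet> (z1 - z2) + c * (f \<bullet> z1 - f \<bullet> z)"
    then have X: "X < 0" by (simp add: X_def)
    define s where "s = - X / (2 * (c + 1))"
    have "0 < s" using X \<open>0 \<le> c\<close> by (simp add: s_def divide_neg_pos)
    then have "0 \<le> X + c * s" using S[OF that, of s] by (simp add: X_def algebra_simps)
    also have "\<dots> \<le> X + (c + 1) * s" using \<open>0 < s\<close> by simp
    also have "\<dots> = X / 2" using \<open>0 \<le> c\<close> by (simp add: s_def field_simps)
    finally show False using X by simp
  qed
  show ?thesis
  proof (intro exI conjI allI impI)
    show "c *\<^sub>R f = (\<theta> + c *\<^sub>R f) + (- \<theta>)" by simp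
    show "\<theta> + c *\<^sub>R f \<noteq> 0 \<or> - \<theta> \<noteq> 0" using p(1) f by (auto simp: zero_prod_def)
    show "(\<theta> + c *\<^sub>R f) \<bullet> y \<le> (\<theta> + c *\<^sub>R f) \<bullet> (u - z)" if "N y \<le> r" for y
      using S0[of "u - y" z] that z
      by (simp add: inner_add_left inner_diff_right algebra_simps)
    show "(- \<theta>) \<bullet> y \<le> (- \<theta>) \<bullet> (v - z)" if "N y \<le> r" for y
      using S0[of z "v - y"] that z
      by (simp add: inner_diff_right algebra_simps)
  qed (rule \<open>0 \<le> c\<close>)
qed

text \<open>
  If \<open>c\<close> is positive in the optimality condition, the highest point \<open>w\<close> lies in the cone spanned by
  \<open>u - z\<close> and \<open>v - z\<close>, hence on the minimal arc. If \<open>c\<close> vanishes, one functional is maximal at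
  \<open>u - z\<close> and minimal at \<open>v - z\<close>. Then \<open>u\<close> and \<open>v\<close> have distance at least \<open>2 * r\<close>, are opposite by
  \<open>wide\<close>, and every point of the circle lies on one of their half-circles.
\<close>
lemma top_of_optimal_disc_pair:
  assumes r: "r > 0" and f: "f \<noteq> 0" and z: "N (u - z) \<le> r" "N (v - z) \<le> r"
    and min: "\<And>z'. N (u - z') \<le> r \<Longrightarrow> N (v - z') \<le> r \<Longrightarrow> f \<bullet> z \<le> f \<bullet> z'"
    and wide: "strictly_convex N \<or> N (u - v) \<le> r"
    and not_u: "\<not> (\<forall>y\<in>disc N z r. f \<bullet> y \<le> f \<bullet> u)"
    and not_v: "\<not> (\<forall>y\<in>disc N z r. f \<bullet> y \<le> f \<bullet> v)"
  shows "N (u - z) = r \<and> N (v - z) = r \<and> u \<noteq> v \<and>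
    (\<exists>A w. minimal_arc N z r u v A \<and> w \<in> A \<and> (\<forall>y\<in>disc N z r. f \<bullet> y \<le> f \<bullet> w))"
proof -
  define u' where "u' = u - z"
  define v' where "v' = v - z"
  have uv: "u = z + u'" "v = z + v'" "u - v = u' - v'" by (simp_all add: u'_def v'_def)
  have le: "N u' \<le> r" "N v' \<le> r" using z by (auto simp: u'_def v'_def)
  have "disc N 0 r \<noteq> {}" using r by (auto simp: disc_def intro!: exI[of _ 0])
  moreover have "continuous_on (disc N 0 r) (\<lambda>y. f \<bullet> y)" by (intro continuous_intros)
  ultimately obtain w where "w \<in> disc N 0 r" "\<And>y. y \<in> disc N 0 r \<Longrightarrow> f \<bullet> y \<le> f \<bullet> w"
    using continuous_attains_sup[OF compact_disc] by blast
  then have w: "N w \<le> r" "\<And>y. N y \<le> r \<Longrightarrow> f \<bullet> y \<le> f \<bullet> w" by (auto simp: disc_def)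
  have top: "\<forall>y\<in>disc N z r. f \<bullet> y \<le> f \<bullet> (z + x)" if "f \<bullet> w \<le> f \<bullet> x" for x
  proof
    fix y assume "y \<in> disc N z r"
    then have "f \<bullet> (y - z) \<le> f \<bullet> x" using w(2)[of "y - z"] that by (simp add: disc_def)
    then show "f \<bullet> y \<le> f \<bullet> (z + x)" by (simp add: inner_diff_right inner_add_right)
  qed
  have "f \<bullet> u' < f \<bullet> w"
    using not_u top[of u'] unfolding uv(1) by (metis not_le)
  moreover have "f \<bullet> v' < f \<bullet> w"
    using not_v top[of v'] unfolding uv(2) by (metis not_le)
  ultimately have low: "f \<bullet> u' < f \<bullet> w" "f \<bullet> v' < f \<bullet> w" .
  have opposite: ?thesis if Nu: "N u' = r" and opp: "v' = - u'"
  proof -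
    have "N w = r" using support_on_circle[OF r f w] .
    moreover have "w \<noteq> u'" "w \<noteq> - u'" using low opp by auto
    then have "wedge u' w \<noteq> 0"
      using not_parallel_on_circle[OF r Nu \<open>N w = r\<close>] by metis
    ultimately obtain A where "minimal_arc N z r (z + u') (z - u') A" "z + w \<in> A"
      using half_circle_arc[OF r Nu] by metis
    then have "minimal_arc N z r u v A" using opp by (simp add: uv(1,2))
    moreover have "u \<noteq> v"
    proof
      assume "u = v"
      then have "u' = - u'" using opp by (simp add: u'_def v'_def)
      then have "2 *\<^sub>R u' = 0" unfolding scaleR_2 by (simp add: eq_neg_iff_add_eq_0)
      then show False using Nu r by simp
    qed
    moreover have "N (u - z) = r" "N (v - z) = r"
      using Nu opp by (simp_all flip: u'_def v'_def)
    ultimately show ?thesis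
      using \<open>z + w \<in> A\<close> top[OF order_refl] by blast
  qed
  obtain \<phi> \<psi> c where c: "0 \<le> c" "c *\<^sub>R f = \<phi> + \<psi>" "\<phi> \<noteq> 0 \<or> \<psi> \<noteq> 0"
      and \<phi>: "\<And>y. N y \<le> r \<Longrightarrow> \<phi> \<bullet> y \<le> \<phi> \<bullet> u'" and \<psi>: "\<And>y. N y \<le> r \<Longrightarrow> \<psi> \<bullet> y \<le> \<psi> \<bullet> v'"
    using optimal_center_supports[OF r f z min, folded u'_def v'_def] by blast
  show ?thesis
  proof (cases "c = 0")
    case True
    then have \<psi>_eq: "\<psi> = - \<phi>" using c(2) by (simp add: eq_neg_iff_add_eq_0 add.commute[of \<psi>])
    then have "\<phi> \<noteq> 0" using c(3) by auto
    have on: "N u' = r" "N v' = r"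
      using support_on_circle[OF r \<open>\<phi> \<noteq> 0\<close> le(1) \<phi>] support_on_circle[OF r _ le(2) \<psi>] \<psi>_eq \<open>\<phi> \<noteq> 0\<close>
      by auto
    have b: "r * \<bar>\<phi> \<bullet> x\<bar> \<le> (\<phi> \<bullet> u') * N x" for x
      by (rule support_bound[OF r \<phi>])
    have "0 < r * \<bar>\<phi> \<bullet> \<phi>\<bar>" using r \<open>\<phi> \<noteq> 0\<close> by simp
    then have a: "0 < \<phi> \<bullet> u'" using b[of \<phi>] N_nonneg[of \<phi>]
      by (metis less_le_trans linorder_not_less mult_nonpos_nonneg)
    have "\<phi> \<bullet> u' \<le> - (\<phi> \<bullet> v')" using \<psi>[of "- u'"] on \<psi>_eq by simp
    then have "(\<phi> \<bullet> u') * (2 * r) \<le> r * \<bar>\<phi> \<bullet> (u' - v')\<bar>"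
      using r by (simp add: inner_diff_right)
    also have "\<dots> \<le> (\<phi> \<bullet> u') * N (u' - v')" by (rule b)
    finally have far: "2 * r \<le> N (u' - v')" using a by simp
    then have "strictly_convex N" using wide uv r by auto
    then have "u' = - v'" using strictly_convex_sum_eq[of r u' "- v'"] r on far by simp
    then have "v' = - u'" by simp
    then show ?thesis by (rule opposite[OF on(1)])
  next
    case False
    then have "0 < c" using c(1) by simp
    have cf: "(\<phi> + \<psi>) \<bullet> y = c * (f \<bullet> y)" for y
      unfolding c(2)[symmetric] by simp
    have "N u' = r \<and> N v' = r \<and> N w = r \<and> (v' = - u' \<or>
      wedge u' v' \<noteq> 0 \<and> (\<exists>\<alpha> \<beta>. 0 \<le> \<alpha> \<and> 0 \<le> \<beta> \<and> w = \<alpha> *\<^sub>R u' + \<beta> *\<^sub>R v'))"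
      by (rule sum_of_supports_attained_between[OF r le(1) \<phi> le(2) \<psi> w(1)])
        (use w(2) low \<open>0 < c\<close> in \<open>auto simp: cf\<close>)
    then consider "N u' = r" "v' = - u'" |
      \<alpha> \<beta> where "N u' = r" "N v' = r" "N w = r" "wedge u' v' \<noteq> 0" "0 \<le> \<alpha>" "0 \<le> \<beta>" "w = \<alpha> *\<^sub>R u' + \<beta> *\<^sub>R v'"
      by blast
    then show ?thesis
    proof cases
      case 1
      then show ?thesis by (rule opposite)
    next
      case 2
      then obtain A where "minimal_arc N z r (z + u') (z + v') A" "z + w \<in> A"
        using sector_arc[OF r, of u' v' z] by metis
      then have "minimal_arc N z r u v A" by (simp add: uv(1,2))
      moreover have "u' \<noteq> v'" using 2(4) by auto
      then have "u \<noteq> v" by (simp add: u'_def v'_def)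
      moreover have "N (u - z) = r" "N (v - z) = r" using 2 by (simp_all flip: u'_def v'_def)
      ultimately show ?thesis using \<open>z + w \<in> A\<close> top[OF order_refl] by blast
    qed
  qed
qed

text \<open>
  A convex set that misses the intersection of all discs misses the intersection of two of them: in the
  plane, Helly's theorem yields three members of the family with empty intersection, and these
  cannot all be discs because \<open>z\<close> lies in every disc.
\<close>
lemma intersecting_discs_Helly:
  assumes "finite K" "K \<noteq> {}" and conv: "convex S"
    and Z: "K \<subseteq> disc N z r" and empty: "\<And>x. x \<in> S \<Longrightarrow> \<not> K \<subseteq> disc N x r"
  obtains u v where "u \<in> K" "v \<in> K" "\<And>x. \<lbrakk>x \<in> S; N (u - x) \<le> r\<rbrakk> \<Longrightarrow> r < N (v - x)"
proof -
  define B where "B k = disc N k r" for k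
  have B: "x \<in> B k \<longleftrightarrow> N (k - x) \<le> r" for x k by (simp add: B_def disc_def N_minus_commute)
  have "\<exists>u\<in>K. \<exists>v\<in>K. S \<inter> B u \<inter> B v = {}"
  proof (rule ccontr)
    assume "\<not> ?thesis"
    then have pair: "\<And>u v. \<lbrakk>u \<in> K; v \<in> K\<rbrakk> \<Longrightarrow> S \<inter> B u \<inter> B v \<noteq> {}" by blast
    define F where "F = insert S (B ` K)"
    \<comment> \<open>Stated for at most two discs, so that it also covers families too small for Helly's theorem.\<close>
    have triple: "\<Inter>t \<noteq> {}" if t: "t \<subseteq> F" and small: "card (t - {S}) \<le> 2" "finite t" and S: "S \<in> t" for t
    proof -
      have "t - {S} \<subseteq> B ` K" using t by (auto simp: F_def)
      obtain k where "k \<in> K" using assms by blast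
      have "\<exists>u\<in>K. \<exists>v\<in>K. t - {S} \<subseteq> {B u, B v}"
      proof -
        consider "t - {S} = {}" | a where "t - {S} = {a}" | a b where "t - {S} = {a, b}"
        proof -
          have "card (t - {S}) = 0 \<or> card (t - {S}) = 1 \<or> card (t - {S}) = 2" using small by linarith
          then show thesis
            using that small by (auto simp: card_1_singleton_iff card_2_iff)
        qed
        then show ?thesis
        proof cases
          case 1 then show ?thesis using \<open>k \<in> K\<close> by blast
        next
          case 2 then show ?thesis using \<open>t - {S} \<subseteq> B ` K\<close> by auto
        next
          case 3 then show ?thesis using \<open>t - {S} \<subseteq> B ` K\<close> by auto
        qed
      qed
      then obtain u v where "u \<in> K" "v \<in> K" "t - {S} \<subseteq> {B u, B v}" by blast
      then have "S \<inter> B u \<inter> B v \<subseteq> \<Inter>t" by blast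
      then show ?thesis using pair[OF \<open>u \<in> K\<close> \<open>v \<in> K\<close>] by blast
    qed
    have "finite F" using assms by (simp add: F_def)
    have "\<Inter>F \<noteq> {}"
    proof (cases "card F \<ge> 3")
      case True
      show ?thesis
      proof (rule Helly)
        show "card F \<ge> DIM(plane) + 1" using True by simp
        show "\<forall>s\<in>F. convex s" using conv convex_disc by (auto simp: F_def B_def)
        fix t assume t: "t \<subseteq> F" "card t = DIM(plane) + 1"
        then have fin: "finite t" using \<open>finite F\<close> finite_subset by blast
        show "\<Inter>t \<noteq> {}"
        proof (cases "S \<in> t")
          case True
          then show ?thesis using triple[OF t(1)] t(2) fin by (simp add: card_Diff_singleton)
        next
          case False
          then have "t \<subseteq> B ` K" using t(1) by (auto simp: F_def)
          then have "z \<in> \<Inter>t" using Z by (force simp: B disc_def)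
          then show ?thesis by blast
        qed
      qed
    next
      case False
      have "S \<in> F" by (simp add: F_def)
      then show ?thesis using triple[of F] False \<open>finite F\<close> by (simp add: card_Diff_singleton)
    qed
    then obtain x where "x \<in> S" "\<And>k. k \<in> K \<Longrightarrow> x \<in> B k" by (auto simp: F_def)
    then show False using empty[of x] by (auto simp: B disc_def)
  qed
  then obtain u v where "u \<in> K" "v \<in> K" "S \<inter> B u \<inter> B v = {}" by blast
  then show ?thesis using that[of u v] B by (force simp: not_le)
qed

text \<open>
  The half-plane of the centres that are better than \<open>z\<close> contains no admissible centre, so two points of
  \<open>K\<close> alone already make \<open>z\<close> optimal.
\<close>
lemma top_of_optimal_disc:
  assumes r: "r > 0" and f: "f \<noteq> 0" and K: "finite K" "K \<noteq> {}"
    and z: "K \<subseteq> disc N z r" and min: "\<And>z'. K \<subseteq> disc N z' r \<Longrightarrow> f \<bullet> z \<le> f \<bullet> z'"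
    and wide: "\<And>u v. \<lbrakk>u \<in> K; v \<in> K\<rbrakk> \<Longrightarrow> strictly_convex N \<or> N (u - v) \<le> r"
  obtains (point) k where "k \<in> K" "\<And>y. y \<in> disc N z r \<Longrightarrow> f \<bullet> y \<le> f \<bullet> k"
  | (arc) u v A w where "u \<in> K" "v \<in> K" "u \<noteq> v" "N (u - z) = r" "N (v - z) = r"
      "minimal_arc N z r u v A" "w \<in> A" "\<And>y. y \<in> disc N z r \<Longrightarrow> f \<bullet> y \<le> f \<bullet> w"
proof -
  have "convex {x. f \<bullet> x < f \<bullet> z}" by (rule convex_halfspace_lt)
  then obtain u v where uv: "u \<in> K" "v \<in> K"
      "\<And>x. \<lbrakk>x \<in> {x. f \<bullet> x < f \<bullet> z}; N (u - x) \<le> r\<rbrakk> \<Longrightarrow> r < N (v - x)"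
    using intersecting_discs_Helly[OF K _ z] min by (metis (no_types, lifting) mem_Collect_eq not_le)
  have "N (u - z) \<le> r" "N (v - z) \<le> r" using uv z by (auto simp: disc_def)
  moreover have "f \<bullet> z \<le> f \<bullet> z'" if "N (u - z') \<le> r" "N (v - z') \<le> r" for z'
    using uv(3)[of z'] that by force
  ultimately show ?thesis
    using top_of_optimal_disc_pair[OF r f, of u z v] wide[OF uv(1,2)] uv(1,2) point arc by blast
qed

section \<open>Excluding a point by a touching disc\<close>
lemma compact_centers:
  assumes "K \<noteq> {}"
  shows "compact {z. K \<subseteq> disc N z r}"
proof -
  have "{z. K \<subseteq> disc N z r} = (\<Inter>k\<in>K. disc N k r)"
    by (auto simp: disc_def N_minus_commute)
  moreover have "compact (\<Inter>k\<in>K. disc N k r)"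
    using assms compact_disc by (intro compact_Inter) auto
  ultimately show ?thesis by simp
qed
text \<open>
  Here \<open>P k f\<close> says that some admissible disc has \<open>k\<close> as a highest point with respect to \<open>f\<close>, and \<open>F\<close> is the
  cone of functionals separating \<open>q\<close> strictly from \<open>C\<close>. Suppose that \<open>q\<close> lies in all touching
  discs. Then exactly one \<open>k\<close> satisfies \<open>P k f\<close> for each \<open>f\<close> in \<open>F\<close>, since a second one would touch the
  same disc. Closedness of \<open>P\<close> in \<open>f\<close> and connectedness of \<open>F\<close> make \<open>k\<close> constant. So \<open>k\<close> maximises
  every \<open>f\<close> in \<open>F\<close> over \<open>C\<close>, and such an \<open>f\<close> cannot approach the boundary of \<open>F\<close> while
  \<open>f(k) < f(q)\<close>: the cone \<open>F\<close> is an open half-plane.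

  On the boundary of this half-plane lies \<open>h\<close>, orthogonal to \<open>d = q - k\<close>. All points of \<open>K\<close> lie on the
  line through \<open>k\<close> and \<open>q\<close>, so the limit disc for \<open>h\<close> touches a second point \<open>k'\<close>. The discs
  on the way to the limit have \<open>k\<close> as their highest point with respect to functionals slightly tilted towards
  \<open>d\<close>; in the limit no point of the disc on this line lies beyond \<open>k\<close> in direction \<open>d\<close>, whereas
  \<open>q\<close> does.
\<close>
lemma touching_disc_excludes:
  assumes r: "r > 0" and K: "finite K" and two: "k\<^sub>1 \<in> K" "k\<^sub>2 \<in> K" "k\<^sub>1 \<noteq> k\<^sub>2"
    and wide: "\<And>u v. \<lbrakk>u \<in> K; v \<in> K\<rbrakk> \<Longrightarrow> strictly_convex N \<or> N (u - v) \<le> r"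
    and covered: "K \<subseteq> disc N z\<^sub>0 r"
    and C: "compact C" "convex C" "K \<subseteq> C" "C \<subseteq> ball_hull N K r"
    and arcs: "\<And>u v x A. \<lbrakk>u \<in> K; v \<in> K; u \<noteq> v; minimal_arc N x r u v A\<rbrakk> \<Longrightarrow> A \<subseteq> C"
    and q: "q \<notin> C"
  shows "\<exists>z. K \<subseteq> disc N z r \<and> q \<notin> disc N z r \<and>
    (\<exists>u\<in>K. \<exists>v\<in>K. u \<noteq> v \<and> N (u - z) = r \<and> N (v - z) = r)"
proof (rule ccontr)
  assume no_disc: "\<not> ?thesis"
  then have touching: "q \<in> disc N z r"
    if "K \<subseteq> disc N z r" "u \<in> K" "v \<in> K" "u \<noteq> v" "N (u - z) = r" "N (v - z) = r" for z u v
    using that no_disc by blast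
  define Z where "Z = {z. K \<subseteq> disc N z r}"
  have "K \<noteq> {}" using two by auto
  then have "compact Z" unfolding Z_def by (rule compact_centers)
  define P where "P k f \<longleftrightarrow> (\<exists>z. z \<in> Z \<and> (\<forall>y\<in>disc N 0 r. f \<bullet> (z + y) \<le> f \<bullet> k))" for k f
  have closed_P: "closed {f. P k f}" for k
  proof -
    have "closed {p :: plane \<times> plane. \<forall>y\<in>disc N 0 r. snd p \<bullet> (fst p + y) \<le> snd p \<bullet> k}"
      unfolding Ball_def
      by (intro closed_Collect_all closed_Collect_imp open_Collect_const closed_Collect_le continuous_intros)
    from closed_compact_projection[OF \<open>compact Z\<close> this]
    show ?thesis by (simp add: P_def)
  qed
  have on_circle: "N (k - z) = r" if "f \<noteq> 0" "z \<in> Z" "k \<in> K" "\<forall>y\<in>disc N 0 r. f \<bullet> (z + y) \<le> f \<bullet> k" for f z k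
  proof (rule support_on_circle[OF r \<open>f \<noteq> 0\<close>])
    show "N (k - z) \<le> r" using that by (auto simp: Z_def disc_def)
    show "f \<bullet> y \<le> f \<bullet> (k - z)" if "N y \<le> r" for y
      using \<open>\<forall>y\<in>disc N 0 r. _\<close> that by (auto simp: disc_def inner_add_right inner_diff_right algebra_simps)
  qed
  have P_le: "f \<bullet> c \<le> f \<bullet> k" if P: "P k f" and c: "c \<in> C" for f k c
  proof -
    obtain z where z: "z \<in> Z" "\<forall>y\<in>disc N 0 r. f \<bullet> (z + y) \<le> f \<bullet> k" using P by (auto simp: P_def)
    then have "c \<in> disc N z r" using c C(4) unfolding Z_def ball_hull_def by blast
    then show ?thesis using bspec[OF z(2), of "c - z"] by (simp add: disc_def)
  qed
  have diff_inner: "(x - y) \<bullet> f = f \<bullet> x - f \<bullet> y" for x y f :: plane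
    by (simp add: inner_commute[of _ f] inner_diff_right)
  define F where "F = (\<Inter>c\<in>C. {f. (q - c) \<bullet> f > 0})"
  have F: "f \<in> F \<longleftrightarrow> (\<forall>c\<in>C. f \<bullet> c < f \<bullet> q)" for f
    by (auto simp: F_def diff_inner)
  have nz: "f \<noteq> 0" if "f \<in> F" for f
    using that C(3) two(1) by (auto simp: F)
  have ex: "\<exists>k\<in>K. P k f" if f: "f \<in> F" for f
  proof -
    have "continuous_on Z (\<lambda>z. f \<bullet> z)" by (intro continuous_intros)
    moreover have "Z \<noteq> {}" using covered by (auto simp: Z_def)
    ultimately obtain z where z: "z \<in> Z" "\<And>z'. z' \<in> Z \<Longrightarrow> f \<bullet> z \<le> f \<bullet> z'"
      using continuous_attains_inf[OF \<open>compact Z\<close>] by blast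
    then have z': "K \<subseteq> disc N z r" "\<And>z'. K \<subseteq> disc N z' r \<Longrightarrow> f \<bullet> z \<le> f \<bullet> z'"
      by (auto simp: Z_def)
    show ?thesis
    proof (rule top_of_optimal_disc[OF r nz[OF f] K \<open>K \<noteq> {}\<close> z' wide])
      fix k assume "k \<in> K" and top: "\<And>y. y \<in> disc N z r \<Longrightarrow> f \<bullet> y \<le> f \<bullet> k"
      have "\<forall>y\<in>disc N 0 r. f \<bullet> (z + y) \<le> f \<bullet> k"
        using top by (auto simp: disc_def)
      then show ?thesis using \<open>k \<in> K\<close> z(1) by (auto simp: P_def)
    next
      fix u v A w
      assume uv: "u \<in> K" "v \<in> K" "u \<noteq> v" "N (u - z) = r" "N (v - z) = r"
        and A: "minimal_arc N z r u v A" "w \<in> A" and top: "\<And>y. y \<in> disc N z r \<Longrightarrow> f \<bullet> y \<le> f \<bullet> w"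
      have "w \<in> C" using arcs[OF uv(1-3) A(1)] A(2) by blast
      then have "f \<bullet> w < f \<bullet> q" using f by (simp add: F)
      moreover have "f \<bullet> q \<le> f \<bullet> w" using top touching[OF z'(1) uv] by blast
      ultimately show ?thesis by simp
    qed
  qed
  have unique: "k = k'" if f: "f \<in> F" and k: "k \<in> K" "k' \<in> K" "P k f" "P k' f" for f k k'
  proof (rule ccontr)
    assume "k \<noteq> k'"
    have eq: "f \<bullet> k = f \<bullet> k'" using P_le k C(3) by (meson order_antisym subsetD)
    obtain z where z: "z \<in> Z" "\<forall>y\<in>disc N 0 r. f \<bullet> (z + y) \<le> f \<bullet> k" using k by (auto simp: P_def)
    then have "N (k - z) = r" "N (k' - z) = r" using on_circle nz[OF f] k eq by simp_all
    then have "q \<in> disc N z r" using touching[of z k k'] z(1) k \<open>k \<noteq> k'\<close> by (auto simp: Z_def)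
    then have "f \<bullet> q \<le> f \<bullet> k" using bspec[OF z(2), of "q - z"] by (simp add: disc_def)
    moreover have "f \<bullet> k < f \<bullet> q" using f k(1) C(3) by (auto simp: F)
    ultimately show False by simp
  qed
  obtain f\<^sub>0 where f0: "f\<^sub>0 \<in> F"
  proof -
    obtain a b where "a \<bullet> q < b" "\<forall>x\<in>C. b < a \<bullet> x"
      using separating_hyperplane_closed_point[OF C(2) compact_imp_closed[OF C(1)] q] by blast
    then have "- a \<in> F" by (force simp: F)
    then show thesis by (rule that)
  qed
  obtain k where k: "k \<in> K" "P k f\<^sub>0" using ex[OF f0] by blast
  have P_on_F: "P k f" if f: "f \<in> F" for f
  proof (rule ccontr)
    assume not_P: "\<not> P k f"
    define B where "B = (\<Union>k'\<in>K - {k}. {f. P k' f})"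
    have "closed B" unfolding B_def using K closed_P by (intro closed_UN) auto
    moreover have "F \<subseteq> {f. P k f} \<union> B" using ex by (auto simp: B_def)
    moreover have "{f. P k f} \<inter> B \<inter> F = {}" using unique k(1) by (auto simp: B_def)
    moreover have "{f. P k f} \<inter> F \<noteq> {}" using k f0 by auto
    moreover have "B \<inter> F \<noteq> {}" using ex[OF f] not_P f by (auto simp: B_def)
    moreover have "connected F"
      unfolding F_def by (intro convex_connected convex_INT convex_halfspace_gt)
    ultimately show False using closed_P[of k] unfolding connected_closed by blast
  qed
  define d where "d = q - k"
  have "q \<noteq> k" using q k C(3) by auto
  then have d: "0 < d \<bullet> d" by (simp add: d_def)
  have F_half_plane: "g \<in> F" if g: "0 < d \<bullet> g" for g
  proof (rule ccontr)
    assume not_F: "g \<notin> F"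
    \<comment> \<open>On the half-plane, the closed sets \<open>A\<close> and \<open>B\<close> are \<open>F\<close> and its complement.\<close>
    define A where "A = {g. \<forall>c\<in>C. g \<bullet> c \<le> g \<bullet> k}"
    define B where "B = {g. \<exists>c. c \<in> C \<and> (c, g) \<in> {p. snd p \<bullet> q \<le> snd p \<bullet> fst p}}"
    have "closed A"
      unfolding A_def Ball_def
      by (intro closed_Collect_all closed_Collect_imp open_Collect_const closed_Collect_le continuous_intros)
    moreover have "closed B"
      unfolding B_def
      by (intro closed_compact_projection C(1) closed_Collect_le continuous_intros)
    moreover have "{g. d \<bullet> g > 0} \<subseteq> A \<union> B"
      using P_on_F P_le by (auto simp: A_def B_def F not_le)
    moreover have "A \<inter> B \<inter> {g. d \<bullet> g > 0} = {}"
      by (force simp: A_def B_def d_def diff_inner)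
    moreover have "f\<^sub>0 \<in> A \<inter> {g. d \<bullet> g > 0}"
      using P_le[OF k(2)] f0 k(1) C(3) by (auto simp: A_def d_def F diff_inner)
    moreover have "g \<in> B \<inter> {g. d \<bullet> g > 0}"
      using g not_F by (auto simp: B_def F not_less)
    moreover have "connected {g. d \<bullet> g > 0}"
      by (intro convex_connected convex_halfspace_gt)
    ultimately show False unfolding connected_closed by blast
  qed
  obtain k' where k': "k' \<in> K" "k' \<noteq> k" using two by metis
  define h where "h = perp d"
  have "h \<noteq> 0" using d by (auto simp: h_def)
  have hd: "d \<bullet> h = 0" by (simp add: h_def inner_commute[of d] inner_perp)
  have hk': "h \<bullet> k' = h \<bullet> k"
  proof (rule ccontr)
    assume "h \<bullet> k' \<noteq> h \<bullet> k"
    then have e: "h \<bullet> (k' - k) \<noteq> 0" by (simp add: inner_diff_right)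
    \<comment> \<open>This \<open>t\<close> makes \<open>g\<close> equal to \<open>1\<close> at \<open>k' - k\<close>, so that \<open>k'\<close> is higher than \<open>k\<close>.\<close>
    define t where "t = (1 - d \<bullet> (k' - k)) / (h \<bullet> (k' - k))"
    define g where "g = t *\<^sub>R h + d"
    have "0 < d \<bullet> g" using d hd by (simp add: g_def inner_add_right)
    then have "g \<bullet> k' \<le> g \<bullet> k"
      using P_le[OF P_on_F[OF F_half_plane]] k'(1) C(3) by blast
    moreover have "g \<bullet> (k' - k) = 1" using e by (simp add: g_def t_def inner_add_left)
    ultimately show False by (simp add: inner_diff_right)
  qed
  define g where "g n = h + inverse (real (Suc n)) *\<^sub>R d" for n
  have "\<exists>z. z \<in> Z \<and> (\<forall>y\<in>disc N 0 r. g n \<bullet> (z + y) \<le> g n \<bullet> k)" for n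
  proof -
    have "0 < d \<bullet> g n" using d hd by (simp add: g_def inner_add_right)
    then show ?thesis using P_on_F[OF F_half_plane] unfolding P_def by blast
  qed
  then obtain s where s: "\<And>n. s n \<in> Z" "\<And>n y. y \<in> disc N 0 r \<Longrightarrow> g n \<bullet> (s n + y) \<le> g n \<bullet> k"
    by metis
  obtain z \<sigma> where z: "z \<in> Z" "strict_mono (\<sigma> :: nat \<Rightarrow> nat)" "(s \<circ> \<sigma>) \<longlonglongrightarrow> z"
    using \<open>compact Z\<close> s(1) unfolding compact_def by metis
  have "g \<longlonglongrightarrow> h + 0 *\<^sub>R d"
    unfolding g_def by (intro tendsto_intros LIMSEQ_inverse_real_of_nat)
  then have g_lim: "(\<lambda>n. g (\<sigma> n)) \<longlonglongrightarrow> h"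
    using LIMSEQ_subseq_LIMSEQ[OF _ z(2)] by (force simp: o_def)
  have s_lim: "(\<lambda>n. s (\<sigma> n)) \<longlonglongrightarrow> z" using z(3) by (simp add: o_def)
  have top: "\<forall>y\<in>disc N 0 r. h \<bullet> (z + y) \<le> h \<bullet> k"
  proof
    fix y assume y: "y \<in> disc N 0 r"
    show "h \<bullet> (z + y) \<le> h \<bullet> k"
    proof (rule LIMSEQ_le)
      show "(\<lambda>n. g (\<sigma> n) \<bullet> (s (\<sigma> n) + y)) \<longlonglongrightarrow> h \<bullet> (z + y)"
        by (intro tendsto_intros g_lim s_lim)
      show "(\<lambda>n. g (\<sigma> n) \<bullet> k) \<longlonglongrightarrow> h \<bullet> k"
        by (intro tendsto_intros g_lim)
    qed (use s(2)[OF y] in blast)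
  qed
  have "N (k - z) = r" "N (k' - z) = r"
    using on_circle[OF \<open>h \<noteq> 0\<close> z(1)] top k(1) k'(1) hk' by auto
  then have q_in: "q \<in> disc N z r" using touching[of z k k'] z(1) k(1) k' by (auto simp: Z_def)
  \<comment> \<open>Moving \<open>q\<close> along with the disc from \<open>z\<close> to \<open>s n\<close> keeps it below \<open>k\<close> with respect to \<open>g n\<close>.
    The part of this inequality along \<open>h\<close> has a sign, and the factor of \<open>d\<close> cancels.\<close>
  have "d \<bullet> d \<le> d \<bullet> (z - s n)" for n
  proof -
    have "g n \<bullet> (s n + (q - z)) \<le> g n \<bullet> k"
      using q_in by (intro s(2)) (simp add: disc_def)
    then have "g n \<bullet> d \<le> g n \<bullet> (z - s n)"
      by (simp add: d_def inner_diff_right inner_add_right)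
    moreover have "h \<bullet> (z + (k - s n)) \<le> h \<bullet> k"
      using s(1)[of n] k(1) by (intro bspec[OF top]) (auto simp: Z_def disc_def)
    then have "h \<bullet> (z - s n) \<le> 0" by (simp add: inner_diff_right inner_add_right)
    moreover have "g n \<bullet> d = h \<bullet> d + inverse (real (Suc n)) * (d \<bullet> d)"
      "g n \<bullet> (z - s n) = h \<bullet> (z - s n) + inverse (real (Suc n)) * (d \<bullet> (z - s n))"
      by (simp_all only: g_def inner_add_left inner_scaleR_left)
    moreover have "h \<bullet> d = 0" using hd by (simp add: inner_commute[of h d])
    ultimately have "inverse (real (Suc n)) * (d \<bullet> d) \<le> inverse (real (Suc n)) * (d \<bullet> (z - s n))"
      by linarith
    then show ?thesis
      by (rule mult_left_le_imp_le) simp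
  qed
  then have "d \<bullet> d \<le> d \<bullet> (z - z)"
    by (intro LIMSEQ_le_const[of "\<lambda>n. d \<bullet> (z - s (\<sigma> n))"] tendsto_intros s_lim) auto
  then show False using d by simp
qed

end

theorem theorem1:
  fixes N :: "real^2 \<Rightarrow> real"
    and n :: nat
    and p :: "nat \<Rightarrow> real^2"
    and K :: "(real^2) set"
    and lam :: real
  assumes "plane_norm N"
    and "n \<ge> 2"
    and "inj_on p {1..n}"
    and "K = p ` {1..n}"
    and "lam \<ge> circumradius N K"
    and "strictly_convex N \<or> lam \<ge> diam N K"
  shows "ball_hull N K lam = \<Inter>{B \<in> arc_discs N K lam. K \<subseteq> B} \<and>
         \<Inter>{B \<in> arc_discs N K lam. K \<subseteq> B} =
           convex hull (\<Union>i\<in>{1..n}. \<Union>j\<in>{1..n} - {i}. \<Union>(minimal_arcs N lam (p i) (p j)))"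
proof -
  interpret normed_plane N by standard fact
  define M where "M = (\<Union>i\<in>{1..n}. \<Union>j\<in>{1..n} - {i}. \<Union>(minimal_arcs N lam (p i) (p j)))"
  define T where "T = \<Inter>{B \<in> arc_discs N K lam. K \<subseteq> B}"
  have "finite K" using assms(4) by simp
  have two: "p 1 \<in> K" "p 2 \<in> K" "p 1 \<noteq> p 2"
    using assms(2,4) inj_onD[OF assms(3), of 1 2] by auto
  have dist: "N (u - v) \<le> 2 * lam" if "u \<in> disc N z lam" "v \<in> disc N z lam" for u v z
    using that N_triangle[of "u - z" "z - v"] by (simp add: disc_def N_minus_commute)
  obtain z\<^sub>0 where z0: "K \<subseteq> disc N z\<^sub>0 lam"
    using ex_covering_disc[OF \<open>finite K\<close> _ assms(5)] two by blast
  have "0 < N (p 1 - p 2)" using two by simp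
  also have "\<dots> \<le> 2 * lam" using dist z0 two by blast
  finally have lam: "0 < lam" by simp
  have wide: "strictly_convex N \<or> N (u - v) \<le> lam" if "u \<in> K" "v \<in> K" for u v
  proof -
    have "finite ((\<lambda>(x, y). N (x - y)) ` (K \<times> K))" using \<open>finite K\<close> by simp
    moreover have "{N (x - y) |x y. x \<in> K \<and> y \<in> K} = (\<lambda>(x, y). N (x - y)) ` (K \<times> K)"
      by auto
    ultimately have "N (u - v) \<le> diam N K"
      unfolding diam_def using that by (intro Max_ge) auto
    then show ?thesis using assms(6) by linarith
  qed
  have arcs: "A \<subseteq> M" if "u \<in> K" "v \<in> K" "u \<noteq> v" "minimal_arc N x lam u v A" for u v x A
  proof -
    obtain i j where "i \<in> {1..n}" "j \<in> {1..n}" "u = p i" "v = p j"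
      using \<open>u \<in> K\<close> \<open>v \<in> K\<close> assms(4) by blast
    then show ?thesis using that(3,4) unfolding M_def minimal_arcs_def by blast
  qed
  have "compact M"
    unfolding M_def
  proof (intro compact_UN compact_union_minimal_arcs lam)
    fix i j assume ij: "i \<in> {1..n}" "j \<in> {1..n} - {i}"
    then show "p i \<noteq> p j" using assms(3) by (auto dest: inj_onD)
    show "strictly_convex N \<or> N (p i - p j) \<le> lam"
      using ij assms(4) by (intro wide) auto
  qed auto
  then have "compact (convex hull M)" by (rule compact_convex_hull)
  have "M \<subseteq> ball_hull N K lam"
  proof
    fix y assume "y \<in> M"
    then obtain i j A x where ij: "i \<in> {1..n}" "j \<in> {1..n}"
        and A: "minimal_arc N x lam (p i) (p j) A" "y \<in> A"
      unfolding M_def minimal_arcs_def by blast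
    have "p i \<in> K" "p j \<in> K" using ij assms(4) by auto
    then have "y \<in> disc N z lam" if "K \<subseteq> disc N z lam" for z
      using minimal_arc_in_disc[OF lam A(1) wide] A(2) that by blast
    then show "y \<in> ball_hull N K lam" unfolding ball_hull_def by blast
  qed
  then have hull_le: "convex hull M \<subseteq> ball_hull N K lam"
    using ball_hull_convex by (rule hull_minimal)
  have "K \<subseteq> M"
  proof
    fix k assume "k \<in> K"
    obtain k' where k': "k' \<in> K" "k \<noteq> k'" using two by metis
    obtain x where x: "N (k - x) = lam" "N (k' - x) = lam"
      using ex_common_circle[OF lam] dist z0 \<open>k \<in> K\<close> k'(1) by (metis subsetD)
    obtain A where A: "minimal_arc N x lam k k' A"
      using ex_minimal_arc[OF lam x k'(2)] by blast
    have "k \<in> A" using minimal_arc_on_circle(1)[OF A] .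
    then show "k \<in> M" using arcs[OF \<open>k \<in> K\<close> k' A] by blast
  qed
  then have "K \<subseteq> convex hull M" by (rule order_trans) (rule hull_subset)
  have "T \<subseteq> convex hull M"
  proof
    fix q assume "q \<in> T"
    show "q \<in> convex hull M"
    proof (rule ccontr)
      assume q: "q \<notin> convex hull M"
      have hull_arcs: "A \<subseteq> convex hull M"
        if "u \<in> K" "v \<in> K" "u \<noteq> v" "minimal_arc N x lam u v A" for u v x A
        using arcs[OF that] by (rule order_trans) (rule hull_subset)
      have "\<exists>z. K \<subseteq> disc N z lam \<and> q \<notin> disc N z lam \<and>
        (\<exists>u\<in>K. \<exists>v\<in>K. u \<noteq> v \<and> N (u - z) = lam \<and> N (v - z) = lam)"
        by (rule touching_disc_excludes[OF lam \<open>finite K\<close> two _ z0 \<open>compact (convex hull M)\<close>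
            convex_convex_hull \<open>K \<subseteq> convex hull M\<close> hull_le _ q]) (fact wide, fact hull_arcs)
      then obtain z u v where z: "K \<subseteq> disc N z lam" "q \<notin> disc N z lam"
        and uv: "u \<in> K" "v \<in> K" "u \<noteq> v" "N (u - z) = lam" "N (v - z) = lam" by blast
      obtain A where "minimal_arc N z lam u v A"
        using ex_minimal_arc[OF lam uv(4,5,3)] by blast
      then have "disc N z lam \<in> arc_discs N K lam"
        unfolding arc_discs_def minimal_arc_def using uv(1-3) by blast
      then show False using z \<open>q \<in> T\<close> unfolding T_def by blast
    qed
  qed
  moreover have "ball_hull N K lam \<subseteq> T"
    unfolding T_def ball_hull_def arc_discs_def by blast
  ultimately show ?thesis using hull_le unfolding T_def M_def by blast
qed

end
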